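(* Let $n=2^vm$ with $m$ odd and $v>0$, and let $x^n+1=(x+1)^{2^v}r_1^{2^v}\cdots r_k^{2^v}$ in $\mathbb{F}_2[x]$, where $r_1,\ldots,r_k$ are monic prime self-reciprocal polynomials of even degree. Set \[ G_i(z)=1+\sum_{j=1}^{2^v}\left(2^{\frac{j\deg(r_i)}{2}}-2^{\frac{(j-1)\deg(r_i)}{2}}\right)z^{j\deg(r_i)}. \] Then \[ \mathcal{G}_n(z)=\sum_{t=0}^n\mathcal{N}_n(n-t)z^t=\left(1+\sum_{j=1}^{2^{v-1}-1}2^{j-1}z^{2j}\right)\prod_{i=1}^kG_i(z), \] and \[ \mathcal{H}_n(z)=\sum_{t=0}^n\mathcal{M}_n(n-t)z^t=\left(1+\sum_{j=1}^{2^{v-1}}2^{j-1}z^{2j}\right)\prod_{i=1}^kG_i(z). \]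
   Context: $\mathrm{Tr}_n:\mathbb{F}_{2^n}\to\mathbb{F}_2$ is the absolute trace and $\mathrm{Tr}_{n/2}:\mathbb{F}_{2^{n/2}}\to\mathbb{F}_2$ the absolute trace of $\mathbb{F}_{2^{n/2}}$. The Walsh transform of $f:\mathbb{F}_{2^n}\to\mathbb{F}_2$ is $\widehat f(b)=\sum_{x\in\mathbb{F}_{2^n}}(-1)^{f(x)+\mathrm{Tr}_n(bx)}$; for an integer $0\le s\le n$, $f$ is $s$-plateaued if $|\widehat f(b)|\in\{0,2^{(n+s)/2}\}$ for all $b$. $\mathcal{C}_1$: functions $Q(x)=\mathrm{Tr}_n\big(\sum_{i=1}^{\lfloor (n-1)/2\rfloor}a_ix^{2^i+1}\big)$, $a_i\in\mathbb{F}_2$; $\mathcal{C}_2$ (even $n$): $Q(x)=\mathrm{Tr}_n\big(\sum_{i=1}^{n/2-1}a_ix^{2^i+1}\big)+\mathrm{Tr}_{n/2}(a_{n/2}x^{2^{n/2}+1})$, $a_i\in\mathbb{F}_2$; the zero function (all $a_i=0$) is included and is $n$-plateaued. $\mathcal{N}_n(s)$ (resp. $\mathcal{M}_n(s)$) is the number of coefficient tuples for which the corresponding function in $\mathcal{C}_1$ (resp. $\mathcal{C}_2$) is $s$-plateaued. For $f\in\mathbb{F}_2[x]$ with $f(0)\ne0$, $f^*(x)=x^{\deg f}f(1/x)$; $f$ is self-reciprocal if $f^*=f$. A monic polynomial $f$ is prime self-reciprocal if either $f$ is irreducible and self-reciprocal, or $f=ugg^*$ with $g$ monic irreducible, $g^*$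 not a constant multiple of $g$, and $u$ a nonzero constant. *)

theory Defs
  imports
    Complex_Main
    "HOL-Library.FuncSet"
    "HOL-Library.Z2"
    "HOL-Computational_Algebra.Computational_Algebra"
begin

text \<open>
  The two-element field is the type \<^typ>\<open>bit\<close>, and the field with \<open>2 ^ n\<close> elements is any
  type \<open>'a\<close> of class \<open>{finite, field}\<close> with \<open>CARD('a) = 2 ^ n\<close>. The field embedding of
  \<^typ>\<open>bit\<close> into \<open>'a\<close> is the library's \<open>of_bit\<close>.

  The field with \<open>2 ^ k\<close> elements, for \<open>k\<close> dividing \<open>n\<close>, is the set of \<open>y\<close> in \<open>'a\<close> with
  \<open>y ^ (2 ^ k) = y\<close>. So \<open>abs_trace k\<close> is the absolute trace of that subfield and is
  meaningful only on its elements; \<open>abs_trace n\<close> is the absolute trace of \<open>'a\<close> itself.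
\<close>

definition abs_trace :: "nat \<Rightarrow> 'a::field \<Rightarrow> bit" where
  "abs_trace k y = (THE c. of_bit c = (\<Sum>i<k. y ^ (2 ^ i)))"

lemma of_bit_abs_trace:
  fixes y :: "'a::field"
  assumes "CHAR('a) = 2" and "y ^ (2 ^ k) = y"
  shows "of_bit (abs_trace k y) = (\<Sum>i<k. y ^ (2 ^ i))"
proof -
  define s where "s = (\<Sum>i<k. y ^ (2 ^ i))"
  have "s ^ CHAR('a) = (\<Sum>i<k. (y ^ (2 ^ i)) ^ CHAR('a))"
    unfolding s_def by (rule freshmans_dream_sum) (simp_all add: assms(1))
  hence "s ^ 2 = (\<Sum>i<k. y ^ (2 ^ Suc i))"
    by (simp add: assms(1) mult.commute flip: power_mult)
  also have "\<dots> = s + y ^ (2 ^ k) - y"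
  proof -
    have "y + (\<Sum>i<k. y ^ (2 ^ Suc i)) = (\<Sum>i<Suc k. y ^ (2 ^ i))"
      by (subst sum.lessThan_Suc_shift) simp
    thus ?thesis
      by (simp add: s_def algebra_simps)
  qed
  finally have "s * (s - 1) = 0"
    by (simp add: assms(2) power2_eq_square algebra_simps)
  then obtain c :: bit where c: "of_bit c = s"
    by (metis dvd_0_right eq_iff_diff_eq_0 mult_eq_0_iff odd_one of_bool_eq(1,2))
  have "abs_trace k y = c"
    unfolding abs_trace_def s_def[symmetric]
  proof (rule the_equality)
    show "of_bit c = s" by (fact c)
  next
    fix d :: bit
    assume "of_bit d = s"
    with c have "of_bit d = (of_bit c :: 'a)" by simp
    thus "d = c" by (cases c; cases d) simp_all
  qed
  with c s_def show ?thesis by simp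
qed

definition walsh :: "nat \<Rightarrow> ('a::{finite, field} \<Rightarrow> bit) \<Rightarrow> 'a \<Rightarrow> int" where
  "walsh n f b = (\<Sum>x\<in>UNIV. (- 1) ^ (of_bit (f x + abs_trace n (b * x)) :: nat))"

definition plateaued :: "nat \<Rightarrow> nat \<Rightarrow> ('a::{finite, field} \<Rightarrow> bit) \<Rightarrow> bool" where
  "plateaued n s f \<longleftrightarrow>
     s \<le> n \<and> (\<forall>b. \<bar>real_of_int (walsh n f b)\<bar> \<in> {0, 2 powr ((real n + real s) / 2)})"

definition Q1 :: "nat \<Rightarrow> (nat \<Rightarrow> bit) \<Rightarrow> 'a::{finite, field} \<Rightarrow> bit" where
  "Q1 n a x = abs_trace n (\<Sum>i = 1..(n - 1) div 2. of_bit (a i) * x ^ (2 ^ i + 1))"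

text \<open>
  For even \<open>n\<close>. The element \<open>x ^ (2 ^ (n div 2) + 1)\<close> lies in the subfield with
  \<open>2 ^ (n div 2)\<close> elements.
\<close>

definition Q2 :: "nat \<Rightarrow> (nat \<Rightarrow> bit) \<Rightarrow> 'a::{finite, field} \<Rightarrow> bit" where
  "Q2 n a x =
     abs_trace n (\<Sum>i = 1..n div 2 - 1. of_bit (a i) * x ^ (2 ^ i + 1)) +
     abs_trace (n div 2) (of_bit (a (n div 2)) * x ^ (2 ^ (n div 2) + 1))"

text \<open>
  The counts range over coefficient tuples, i.e. extensional functions on the index set.
\<close>

definition count1 :: "'a::{finite, field} itself \<Rightarrow> nat \<Rightarrow> nat \<Rightarrow> nat" where
  "count1 _ n s =
     card {a \<in> {1..(n - 1) div 2} \<rightarrow>\<^sub>E (UNIV :: bit set). plateaued n s (Q1 n a :: 'a \<Rightarrow> bit)}"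

definition count2 :: "'a::{finite, field} itself \<Rightarrow> nat \<Rightarrow> nat \<Rightarrow> nat" where
  "count2 _ n s =
     card {a \<in> {1..n div 2} \<rightarrow>\<^sub>E (UNIV :: bit set). plateaued n s (Q2 n a :: 'a \<Rightarrow> bit)}"

definition self_reciprocal :: "'b::field poly \<Rightarrow> bool" where
  "self_reciprocal f \<longleftrightarrow> coeff f 0 \<noteq> 0 \<and> reflect_poly f = f"

definition prime_self_reciprocal :: "'b::field poly \<Rightarrow> bool" where
  "prime_self_reciprocal f \<longleftrightarrow>
     lead_coeff f = 1 \<and>
     (irreducible f \<and> self_reciprocal f \<or>
      (\<exists>u g. u \<noteq> 0 \<and> lead_coeff g = 1 \<and> irreducible g \<and> coeff g 0 \<noteq> 0 \<and>
             (\<nexists>c. reflect_poly g = smult c g) \<and> f = smult u (g * reflect_poly g)))"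

text \<open>
  \<open>G_factor v d\<close> is \<open>G_i(z)\<close> for \<open>d = deg r_i\<close>, as a polynomial in \<open>z\<close>; \<open>d\<close> is even wherever
  it is used, so the divisions by 2 are exact.
\<close>

definition G_factor :: "nat \<Rightarrow> nat \<Rightarrow> int poly" where
  "G_factor v d =
     1 + (\<Sum>j = 1..2 ^ v. monom (2 ^ (j * d div 2) - 2 ^ ((j - 1) * d div 2)) (j * d))"

end

theory Submission
  imports Defs "HOL-Computational_Algebra.Field_as_Ring"
begin

text \<open>
  The polarisation of a quadratic form in the two classes is \<open>(x, u) \<mapsto> Tr (x \<cdot> A(\<sigma>) u)\<close>, where \<open>\<sigma>\<close> is the
  Frobenius map and \<open>A\<close> is a palindrome of length \<open>n + 1\<close> with vanishing constant term. Squaring the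
  Walsh transform shows that the form is \<open>s\<close>-plateaued iff the kernel of \<open>A(\<sigma>)\<close> has dimension \<open>s\<close>,
  and this dimension is the degree of \<open>gcd(A, x^n + 1)\<close>.

  Put \<open>p_0 = (x + 1)^2\<close> with exponent \<open>N_0 = 2^(v-1)\<close> and \<open>p_i = r_i\<close> with exponent \<open>N_i = 2^v\<close>, so that
  \<open>x^n + 1 = \<Prod> p_i^N_i\<close>. Each \<open>p_i\<close> is self-reciprocal of even degree \<open>d_i\<close>, and symmetry forces
  \<open>gcd(A, x^n + 1) = \<Prod> p_i^e_i\<close>. The palindromes divisible by \<open>\<Prod> p_i^e_i\<close> number \<open>\<Prod> 2^((N_i - e_i) d_i / 2)\<close>,
  a product over \<open>i\<close>, so by inversion those with prescribed gcd are also counted by a product, which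
  gives the factorisation of the generating function. The first class consists of the
  palindromes with vanishing middle coefficient, i.e. those with \<open>e_0 \<ge> 1\<close>.
\<close>

section \<open>Linearised polynomials over the two-element field\<close>

declare add_bit_eq_xor [simp del] mult_bit_eq_and [simp del] power_bit_unfold [simp del]
  sum_of_bool_mult_eq [simp del] sum_mult_of_bool_eq [simp del]

text \<open>Making \<open>bit\<close> a \<open>field_gcd\<close> turns \<open>bit poly\<close> into
  a Euclidean ring with gcds and prime factorisations, in which gcds with x^n + 1 can be
  formed.\<close>

instantiation bit ::
  "{unique_euclidean_ring, normalization_euclidean_semiring, normalization_semidom_multiplicative}"
begin

definition [simp]: "normalize_bit = (normalize_field :: bit \<Rightarrow> _)"
definition [simp]: "unit_factor_bit = (unit_factor_field :: bit \<Rightarrow> _)"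
definition [simp]: "euclidean_size_bit = (euclidean_size_field :: bit \<Rightarrow> _)"
definition [simp]: "division_segment (x :: bit) = 1"

instance
  by standard (simp_all add: dvd_field_iff mult_bit_eq_and split: if_splits)

end

instantiation bit :: euclidean_ring_gcd
begin

definition gcd_bit :: "bit \<Rightarrow> bit \<Rightarrow> bit" where
  "gcd_bit = Euclidean_Algorithm.gcd"
definition lcm_bit :: "bit \<Rightarrow> bit \<Rightarrow> bit" where
  "lcm_bit = Euclidean_Algorithm.lcm"
definition Gcd_bit :: "bit set \<Rightarrow> bit" where
  "Gcd_bit = Euclidean_Algorithm.Gcd"
definition Lcm_bit :: "bit set \<Rightarrow> bit" where
  "Lcm_bit = Euclidean_Algorithm.Lcm"

instance
  by standard (simp_all add: gcd_bit_def lcm_bit_def Gcd_bit_def Lcm_bit_def)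

end

instance bit :: field_gcd ..

lemma uminus_bit_poly [simp]: "- p = (p :: bit poly)"
  by (simp add: poly_eq_iff)

lemma add_self_bit_poly [simp]: "p + p = (0 :: bit poly)"
  using add.right_inverse[of p] by simp

section \<open>Finite fields with \<open>2 ^ n\<close> elements\<close>

locale binary_field =
  fixes n :: nat and ty :: "'a::{finite, field} itself"
  assumes card_UNIV: "card (UNIV :: 'a set) = 2 ^ n"
begin

text \<open>Translation by 1 permutes the field, so comparing the sum of all elements with its
  translate gives \<open>2 ^ n\<close> = 0 in the field, hence 2 = 0.\<close>

lemma two_eq_zero: "(2 :: 'a) = 0"
proof -
  have "(\<Sum>x\<in>UNIV. x) = (\<Sum>x\<in>UNIV. x + 1 :: 'a)"
    by (rule sum.reindex_bij_witness[of _ "\<lambda>x. x + 1" "\<lambda>x. x - 1"]) auto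
  hence "(of_nat (card (UNIV :: 'a set)) :: 'a) = 0"
    by (simp add: sum.distrib)
  thus ?thesis
    by (simp add: card_UNIV)
qed

lemma char_2: "CHAR('a) = 2"
proof -
  have "CHAR('a) dvd 2"
    using two_eq_zero of_nat_eq_0_iff_char_dvd[where 'a = 'a, of 2] by simp
  moreover have "CHAR('a) \<noteq> 1"
    by simp
  ultimately show ?thesis
    using prime_nat_iff two_is_prime_nat by blast
qed

lemma add_self [simp]: "x + x = (0 :: 'a)"
  using two_eq_zero by (metis mult_2 mult_zero_left)

lemma n_pos: "n > 0"
proof (rule ccontr)
  assume "\<not> n > 0"
  hence "card (UNIV :: 'a set) = 1"
    using card_UNIV by simp
  moreover have "card {0, 1 :: 'a} \<le> card (UNIV :: 'a set)"
    by (rule card_mono) auto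
  ultimately show False by simp
qed

text \<open>Multiplication by a nonzero x permutes the nonzero elements; comparing the products
  before and after gives x^(2^n - 1) = 1.\<close>

lemma power_card: "x ^ (2 ^ n) = (x :: 'a)"
proof (cases "x = 0")
  case False
  let ?U = "UNIV - {0 :: 'a}"
  have "\<Prod>?U = (\<Prod>y\<in>?U. x * y)"
    by (rule prod.reindex_bij_witness[of _ "\<lambda>y. x * y" "\<lambda>y. y / x"]) (use False in auto)
  also have "\<dots> = x ^ card ?U * \<Prod>?U"
    by (simp add: prod.distrib)
  finally have "x ^ card ?U = 1"
    by (simp add: prod_zero_iff)
  moreover have "2 ^ n = Suc (card ?U)"
    using card_UNIV by (metis UNIV_I card_Suc_Diff1 finite)
  ultimately show ?thesis by simp
qed (simp add: n_pos)

lemma add_power: "(x + y) ^ (2 ^ i) = x ^ (2 ^ i) + (y :: 'a) ^ (2 ^ i)"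
proof (induction i)
  case (Suc i)
  have sq: "(a + b)\<^sup>2 = a\<^sup>2 + (b :: 'a)\<^sup>2" for a b
    by (simp add: power2_sum two_eq_zero)
  show ?case
    using Suc sq by (simp add: power_mult mult.commute[of 2])
qed simp

lemma sum_power: "(\<Sum>j\<in>J. g j) ^ (2 ^ i) = (\<Sum>j\<in>J. (g j :: 'a) ^ (2 ^ i))"
  by (induction J rule: infinite_finite_induct) (simp_all add: add_power)

lemma of_bit_add: "of_bit (a + b) = (of_bit a + of_bit b :: 'a)"
  by (cases a; cases b) simp_all

lemma of_bit_power: "(of_bit a :: 'a) ^ (2 ^ i) = of_bit a"
  by (cases a) simp_all

lemma of_bit_inject: "(of_bit a :: 'a) = of_bit b \<longleftrightarrow> a = b"
  by (cases a; cases b) simp_all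

text \<open>The polynomial \<open>p\<close> evaluated at the Frobenius endomorphism.\<close>

definition lin :: "bit poly \<Rightarrow> 'a \<Rightarrow> 'a" where
  "lin p x = (\<Sum>i\<le>degree p. of_bit (coeff p i) * x ^ (2 ^ i))"

lemma lin_eq_sum:
  assumes "degree p \<le> N"
  shows "lin p x = (\<Sum>i\<le>N. of_bit (coeff p i) * x ^ (2 ^ i))"
  unfolding lin_def
  by (rule sum.mono_neutral_left) (use assms in \<open>auto simp: coeff_eq_0\<close>)

lemma lin_0 [simp]: "lin 0 x = 0"
  by (simp add: lin_def)

lemma lin_add: "lin (p + q) x = lin p x + lin q x"
proof -
  let ?N = "max (degree p) (degree q)"
  have "degree (p + q) \<le> ?N" by (rule degree_add_le_max)
  thus ?thesis
    by (simp only: lin_eq_sum[OF \<open>degree (p + q) \<le> ?N\<close>] lin_eq_sum[OF max.cobounded1[of "degree p" "degree q"]]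
        lin_eq_sum[OF max.cobounded2[of "degree q" "degree p"]] coeff_add of_bit_add sum.distrib distrib_right)
qed

lemma lin_sum: "lin (\<Sum>j\<in>J. g j) x = (\<Sum>j\<in>J. lin (g j) x)"
  by (induction J rule: infinite_finite_induct) (simp_all add: lin_add)

lemma lin_monom: "lin (monom c i) x = of_bit c * x ^ (2 ^ i)"
proof -
  have "lin (monom c i) x = (\<Sum>j\<le>i. of_bit (coeff (monom c i) j) * x ^ (2 ^ j))"
    by (rule lin_eq_sum) (rule degree_monom_le)
  also have "\<dots> = (\<Sum>j\<in>{i}. of_bit (coeff (monom c i) j) * x ^ (2 ^ j))"
    by (rule sum.mono_neutral_right) auto
  finally show ?thesis by simp
qed

lemma lin_add_right: "lin p (x + y) = lin p x + lin p y"
  by (simp add: lin_def add_power sum.distrib distrib_left)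

lemma lin_0_right [simp]: "lin p 0 = 0"
  by (simp add: lin_def zero_power)

lemma lin_smult: "lin (smult a p) x = of_bit a * lin p x"
  by (cases a) simp_all

lemma lin_pCons: "lin (pCons a p) x = of_bit a * x + (lin p x)\<^sup>2"
proof -
  have "lin (pCons a p) x = (\<Sum>i\<le>Suc (degree p). of_bit (coeff (pCons a p) i) * x ^ (2 ^ i))"
    by (rule lin_eq_sum) (rule degree_pCons_le)
  also have "\<dots> = of_bit a * x + (\<Sum>i\<le>degree p. (of_bit (coeff p i) * x ^ (2 ^ i)) ^ (2 ^ 1))"
  proof -
    have "(of_bit c * x ^ (2 ^ i)) ^ (2 ^ 1) = of_bit c * x ^ (2 ^ Suc i)" for c i
      unfolding power_mult_distrib of_bit_power by (simp add: mult.commute flip: power_mult)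
    thus ?thesis
      by (simp only: sum.atMost_Suc_shift coeff_pCons_0 coeff_pCons_Suc power_0 power_one_right)
  qed
  also have "\<dots> = of_bit a * x + (lin p x) ^ (2 ^ 1)"
    by (simp only: lin_def sum_power)
  finally show ?thesis by simp
qed

text \<open>Evaluation at the Frobenius map is a ring homomorphism because the coefficients are
  fixed by squaring. The induction is Horner's scheme via \<open>lin_pCons\<close>.\<close>

lemma lin_mult: "lin (p * q) x = lin p (lin q x)"
proof (induction p)
  case (pCons a p)
  have "lin (pCons a p * q) x = lin (smult a q) x + lin (pCons 0 (p * q)) x"
    by (simp add: lin_add)
  also have "\<dots> = of_bit a * lin q x + (lin p (lin q x))\<^sup>2"
    by (simp add: lin_smult lin_pCons pCons.IH)
  also have "\<dots> = lin (pCons a p) (lin q x)"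
    by (simp add: lin_pCons)
  finally show ?case .
qed simp

lemma lin_x_n_plus_1: "lin (monom 1 n + 1) x = 0"
proof -
  have "lin 1 x = x"
    by (simp add: lin_def)
  thus ?thesis
    by (simp add: lin_add lin_monom power_card)
qed

text \<open>As an ordinary polynomial in x, \<open>lin p\<close> is nonzero of degree at most
  \<open>2 ^ degree p\<close>, which bounds its number of roots.\<close>

lemma card_lin_kernel_le:
  assumes "p \<noteq> 0"
  shows "card {x. lin p x = 0} \<le> 2 ^ degree p"
proof -
  define q :: "'a poly" where "q = (\<Sum>i\<le>degree p. monom (of_bit (coeff p i)) (2 ^ i))"
  have "poly q x = lin p x" for x
    by (simp add: q_def lin_def poly_sum poly_monom)
  moreover have "degree q \<le> 2 ^ degree p"
    unfolding q_def
    by (rule degree_sum_le) (auto intro: order.trans[OF degree_monom_le])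
  moreover have "q \<noteq> 0"
  proof -
    have "coeff q (2 ^ degree p) = (\<Sum>i\<le>degree p. if i = degree p then of_bit (coeff p i) else 0)"
      unfolding q_def by (simp only: coeff_sum coeff_monom) (auto intro: sum.cong)
    also have "\<dots> = of_bit (lead_coeff p)"
      by (simp add: sum.delta)
    finally have "coeff q (2 ^ degree p) = of_bit (lead_coeff p)" .
    moreover have "lead_coeff p = 1"
      using assms by (metis bit_not_zero_iff leading_coeff_0_iff)
    ultimately show ?thesis by auto
  qed
  ultimately show ?thesis
    using card_poly_roots_bound[of q] by simp
qed

text \<open>The fibres over the range are cosets of the kernel. Translation by z maps one to the
  other and is its own inverse in characteristic 2.\<close>

lemma card_lin_kernel_range:
  "2 ^ n = card {x. lin p x = 0} * card (range (lin p))"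
proof -
  have "2 ^ n = card (\<Union>y\<in>range (lin p). {x. lin p x = y})"
    by (subst card_UNIV[symmetric]) (rule arg_cong[where f = card], auto)
  also have "\<dots> = (\<Sum>y\<in>range (lin p). card {x. lin p x = y})"
    by (rule card_UN_disjoint) auto
  also have "\<dots> = (\<Sum>y\<in>range (lin p). card {x. lin p x = 0})"
  proof (rule sum.cong)
    fix y assume "y \<in> range (lin p)"
    then obtain z where z: "y = lin p z" by blast
    have "bij_betw (\<lambda>x. x + z) {x. lin p x = 0} {x. lin p x = y}"
      by (rule bij_betwI[where g = "\<lambda>x. x + z"]) (auto simp: lin_add_right z add.assoc)
    thus "card {x. lin p x = y} = card {x. lin p x = 0}"
      by (simp add: bij_betw_same_card)
  qed simp
  finally show ?thesis by (simp add: mult.commute)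
qed

lemma degree_x_n_plus_1: "degree (monom 1 n + 1 :: bit poly) = n"
  using n_pos by (simp add: degree_add_eq_left degree_monom_eq)

text \<open>If x^n + 1 = d e, the range of \<open>lin d\<close> lies in the kernel of
  \<open>lin e\<close> and so has at most \<open>2 ^ degree e\<close> elements. The kernel of
  \<open>lin d\<close> then has at least \<open>2 ^ degree d\<close> elements, and the degree bound
  is attained.\<close>

lemma card_lin_kernel_dvd:
  assumes "d dvd monom 1 n + 1"
  shows "card {x. lin d x = 0} = 2 ^ degree d"
proof -
  from assms obtain e where e: "monom 1 n + 1 = d * e" ..
  have nz: "(monom 1 n + 1 :: bit poly) \<noteq> 0"
    using degree_x_n_plus_1 n_pos by fastforce
  hence "d \<noteq> 0" "e \<noteq> 0"
    using e by auto
  have deg: "degree d + degree e = n"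
    using degree_mult_eq[OF \<open>d \<noteq> 0\<close> \<open>e \<noteq> 0\<close>] degree_x_n_plus_1 e by simp
  have "range (lin d) \<subseteq> {x. lin e x = 0}"
    using lin_x_n_plus_1 by (auto simp: e mult.commute[of d] lin_mult)
  hence "card (range (lin d)) \<le> card {x. lin e x = 0}"
    by (intro card_mono) auto
  also have "\<dots> \<le> 2 ^ degree e"
    by (rule card_lin_kernel_le) fact
  finally have "2 ^ n \<le> card {x. lin d x = 0} * 2 ^ degree e"
    by (subst card_lin_kernel_range[of d]) simp
  hence "2 ^ degree d * 2 ^ degree e \<le> card {x. lin d x = 0} * (2 ^ degree e :: nat)"
    by (simp flip: deg power_add)
  hence "2 ^ degree d \<le> card {x. lin d x = 0}"
    by simp
  thus ?thesis
    using card_lin_kernel_le[OF \<open>d \<noteq> 0\<close>] by simp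
qed

text \<open>Since x^n + 1 acts as zero, a Bezout identity shows that p and its gcd with x^n + 1 have
  the same kernel.\<close>

lemma card_lin_kernel:
  "card {x. lin p x = 0} = 2 ^ degree (gcd p (monom 1 n + 1))"
proof -
  let ?P = "monom 1 n + 1 :: bit poly" and ?d = "gcd p (monom 1 n + 1)"
  have "lin p x = 0 \<longleftrightarrow> lin ?d x = 0" for x
  proof
    assume "lin p x = 0"
    obtain u w where "?d = u * p + w * ?P"
      by (metis bezout_coefficients_fst_snd)
    thus "lin ?d x = 0"
      using \<open>lin p x = 0\<close> by (simp only: lin_add[of "u * p"] lin_mult lin_x_n_plus_1) simp
  next
    assume *: "lin ?d x = 0"
    obtain q where "p = q * ?d"
      by (metis dvdE gcd_dvd1 mult.commute)
    thus "lin p x = 0"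
      using * lin_mult lin_0_right by metis
  qed
  thus ?thesis
    using card_lin_kernel_dvd[of ?d] by simp
qed

end

section \<open>The Walsh transform of a quadratic form\<close>

abbreviation chi :: "bit \<Rightarrow> int" where
  "chi b \<equiv> (- 1) ^ (of_bit b :: nat)"

lemma chi_add: "chi (a + b) = chi a * chi b"
  by (cases a; cases b) simp_all

text \<open>Orthogonality of characters: translation by some z with \<open>g z = 1\<close> flips the
  sign of every term. A general K is allowed so that it applies to the whole field and to kernels
  alike.\<close>

lemma sum_chi_additive:
  fixes g :: "'a::ab_group_add \<Rightarrow> bit"
  assumes "finite K" "K \<noteq> {}"
    and add: "\<And>x y. x \<in> K \<Longrightarrow> y \<in> K \<Longrightarrow> x + y \<in> K \<and> g (x + y) = g x + g y"
    and diff: "\<And>x y. x \<in> K \<Longrightarrow> y \<in> K \<Longrightarrow> x - y \<in> K"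
  shows "(\<Sum>x\<in>K. chi (g x)) = (if \<forall>x\<in>K. g x = 0 then int (card K) else 0)"
proof (cases "\<forall>x\<in>K. g x = 0")
  case False
  then obtain z where z: "z \<in> K" "g z = 1" by auto
  have "(\<Sum>x\<in>K. chi (g x)) = (\<Sum>x\<in>K. chi (g (x + z)))"
    by (rule sum.reindex_bij_witness[of _ "\<lambda>x. x + z" "\<lambda>x. x - z"]) (use z add diff in auto)
  also have "\<dots> = (\<Sum>x\<in>K. - chi (g x))"
  proof (rule sum.cong)
    fix x assume "x \<in> K"
    hence "g (x + z) = g x + 1" using add z by metis
    thus "chi (g (x + z)) = - chi (g x)"
      by (simp only: chi_add) simp
  qed simp
  finally have "(\<Sum>x\<in>K. chi (g x)) = 0"
    by (simp add: sum_negf)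
  thus ?thesis using False by auto
qed simp

section \<open>The absolute trace, Walsh values and kernels\<close>

context binary_field
begin

abbreviation tr :: "'a \<Rightarrow> bit" where
  "tr \<equiv> abs_trace n"

lemma of_bit_tr: "of_bit (tr y) = (\<Sum>i<n. y ^ (2 ^ i))"
  by (rule of_bit_abs_trace) (simp_all only: char_2 power_card)

lemma tr_add: "tr (x + y) = tr x + tr y"
  by (simp only: of_bit_inject[symmetric] of_bit_add of_bit_tr add_power sum.distrib)

lemma tr_0 [simp]: "tr 0 = 0"
  by (simp only: of_bit_inject[symmetric] of_bit_tr) (simp add: zero_power)

lemma tr_sum: "tr (\<Sum>j\<in>J. g j) = (\<Sum>j\<in>J. tr (g j))"
  by (induction J rule: infinite_finite_induct) (simp_all add: tr_add)

text \<open>Squaring permutes the conjugates in the trace sum cyclically.\<close>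

lemma tr_power: "tr (y ^ (2 ^ j)) = tr y"
proof (induction j)
  case (Suc j)
  have "(of_bit (tr (y\<^sup>2)) :: 'a) = of_bit (tr y)" for y
  proof -
    have "(\<Sum>i<n. (y\<^sup>2) ^ (2 ^ i)) + y = (\<Sum>i<Suc n. y ^ (2 ^ i))"
      by (subst sum.lessThan_Suc_shift) (simp add: add.commute flip: power_mult)
    also have "\<dots> = (\<Sum>i<n. y ^ (2 ^ i)) + y"
      by (simp add: power_card)
    finally show ?thesis by (simp only: of_bit_tr add_right_cancel)
  qed
  hence "tr (y\<^sup>2) = tr y" for y by (simp only: of_bit_inject)
  thus ?case using Suc by (simp add: power_mult mult.commute[of 2])
qed simp

text \<open>Otherwise the trace polynomial, nonzero of degree at most \<open>2 ^ (n - 1)\<close>,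
  would vanish at all \<open>2 ^ n\<close> elements.\<close>

lemma ex_tr_eq_1: "\<exists>z. tr z = 1"
proof (rule ccontr)
  assume "\<nexists>z. tr z = 1"
  hence z: "(\<Sum>i<n. y ^ (2 ^ i)) = (0 :: 'a)" for y
    using of_bit_tr[of y] by simp
  define p :: "'a poly" where "p = (\<Sum>i<n. monom 1 (2 ^ i))"
  have "poly p y = 0" for y
    using z by (simp add: p_def poly_sum poly_monom)
  moreover have "coeff p (2 ^ 0) = (\<Sum>i<n. if i = 0 then 1 else 0)"
    unfolding p_def by (simp only: coeff_sum coeff_monom) (auto intro: sum.cong)
  hence "p \<noteq> 0" using n_pos by (auto simp: sum.delta)
  moreover have "degree p \<le> 2 ^ (n - 1)"
    unfolding p_def
    by (rule degree_sum_le) (auto intro!: order.trans[OF degree_monom_le] power_increasing)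
  ultimately have "card (UNIV :: 'a set) \<le> 2 ^ (n - 1)"
    using card_poly_roots_bound[of p] by simp
  thus False
    using n_pos by (simp add: card_UNIV)
qed

lemma sum_chi_tr: "(\<Sum>x\<in>UNIV. chi (tr (x * c))) = (if c = 0 then 2 ^ n else 0)"
proof -
  have "(\<Sum>x\<in>UNIV. chi (tr (x * c))) =
          (if \<forall>x\<in>UNIV. tr (x * c) = 0 then int (card (UNIV :: 'a set)) else 0)"
    by (rule sum_chi_additive) (simp_all add: distrib_right tr_add)
  moreover have "(\<forall>x. tr (x * c) = 0) \<longleftrightarrow> c = 0"
  proof
    assume *: "\<forall>x. tr (x * c) = 0"
    obtain z where "tr z = 1" using ex_tr_eq_1 by blast
    thus "c = 0" using *[rule_format, of "z / c"] by (cases "c = 0") auto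
  qed simp
  ultimately show ?thesis by (simp add: card_UNIV)
qed

text \<open>After the substitution y = x + u the polarisation identity leaves x only in a character,
  and the sum over x vanishes unless \<open>L u = 0\<close>.\<close>

lemma walsh_square:
  assumes f: "\<And>x u. f (x + u) = f x + f u + tr (x * L u)"
  shows "(walsh n f b)\<^sup>2 = 2 ^ n * (\<Sum>u | L u = 0. chi (f u + tr (b * u)))"
proof -
  have "(walsh n f b)\<^sup>2 =
      (\<Sum>x\<in>UNIV. \<Sum>y\<in>UNIV. chi (f x + tr (b * x)) * chi (f y + tr (b * y)))"
    by (simp only: walsh_def power2_eq_square sum_product)
  also have "\<dots> = (\<Sum>x\<in>UNIV. \<Sum>u\<in>UNIV. chi (f x + tr (b * x)) * chi (f (x + u) + tr (b * (x + u))))"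
  proof (rule sum.cong)
    fix x :: 'a
    show "(\<Sum>y\<in>UNIV. chi (f x + tr (b * x)) * chi (f y + tr (b * y))) =
      (\<Sum>u\<in>UNIV. chi (f x + tr (b * x)) * chi (f (x + u) + tr (b * (x + u))))"
      by (rule sum.reindex_bij_witness[of _ "\<lambda>u. x + u" "\<lambda>y. y - x"]) auto
  qed simp
  also have "\<dots> = (\<Sum>x\<in>UNIV. \<Sum>u\<in>UNIV. chi (f u + tr (b * u)) * chi (tr (x * L u)))"
  proof (intro sum.cong refl)
    fix x u :: 'a
    have sq: "chi c * chi c = 1" for c by (cases c) simp_all
    show "chi (f x + tr (b * x)) * chi (f (x + u) + tr (b * (x + u))) =
            chi (f u + tr (b * u)) * chi (tr (x * L u))"
    proof -
      have "chi (f x + tr (b * x)) * chi (f (x + u) + tr (b * (x + u))) =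
          (chi (f x) * chi (f x)) * (chi (tr (b * x)) * chi (tr (b * x))) *
          (chi (f u + tr (b * u)) * chi (tr (x * L u)))"
        unfolding f distrib_left tr_add chi_add by (simp only: ac_simps)
      thus ?thesis by (simp only: sq mult_1)
    qed
  qed
  also have "\<dots> = (\<Sum>u\<in>UNIV. chi (f u + tr (b * u)) * (\<Sum>x\<in>UNIV. chi (tr (x * L u))))"
    by (subst sum.swap) (simp only: sum_distrib_left)
  also have "\<dots> = (\<Sum>u\<in>UNIV. if L u = 0 then 2 ^ n * chi (f u + tr (b * u)) else 0)"
    unfolding sum_chi_tr by (rule sum.cong) auto
  also have "\<dots> = (\<Sum>u\<in>{u. L u = 0}. 2 ^ n * chi (f u + tr (b * u)))"
    by (rule sum.mono_neutral_cong_right) auto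
  finally show ?thesis by (simp only: sum_distrib_left)
qed

text \<open>Fourier inversion at 0: the Walsh values add up to
  \<open>2 ^ n * chi (f 0)\<close>.\<close>

lemma ex_walsh_nonzero: "\<exists>b :: 'a. walsh n f b \<noteq> 0"
proof (rule ccontr)
  assume "\<nexists>b :: 'a. walsh n f b \<noteq> 0"
  hence "0 = (\<Sum>b :: 'a\<in>UNIV. walsh n f b)"
    by simp
  also have "\<dots> = (\<Sum>x\<in>UNIV. chi (f x) * (\<Sum>b\<in>UNIV. chi (tr (b * x))))"
    unfolding walsh_def chi_add by (subst sum.swap) (simp only: sum_distrib_left)
  also have "\<dots> = (\<Sum>x\<in>{0}. chi (f x) * 2 ^ n)"
    unfolding sum_chi_tr by (rule sum.mono_neutral_cong_right) auto
  finally show False by simp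
qed

text \<open>On the kernel of L the function f + tr(b x) is additive, so every squared Walsh value is
  0 or \<open>2 ^ n\<close> times the size of the kernel. As some value is nonzero, that size
  determines s.\<close>

lemma plateaued_iff:
  assumes f: "\<And>x u. f (x + u) = f x + f u + tr (x * L u)"
    and L: "\<And>x y. L (x + y) = L x + L y"
  shows "plateaued n s f \<longleftrightarrow> s \<le> n \<and> card {x. L x = 0} = 2 ^ s"
proof -
  let ?K = "{x. L x = 0}"
  have L0: "L 0 = 0" using L[of 0 0] by simp
  have minus: "x - y = x + y" for x y :: 'a
    using add_self[of y] by (simp only: diff_eq_eq add.assoc) simp
  have sq: "(walsh n f b)\<^sup>2 = 0 \<or> (walsh n f b)\<^sup>2 = 2 ^ n * int (card ?K)" for b
  proof -
    have "(\<Sum>u\<in>?K. chi (f u + tr (b * u))) =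
        (if \<forall>u\<in>?K. f u + tr (b * u) = 0 then int (card ?K) else 0)"
    proof (rule sum_chi_additive)
      fix x y assume "x \<in> ?K" "y \<in> ?K"
      thus "x + y \<in> ?K \<and> f (x + y) + tr (b * (x + y)) = f x + tr (b * x) + (f y + tr (b * y))"
        by (simp add: L f distrib_left tr_add add_ac)
    qed (use L0 in \<open>auto simp: L minus\<close>)
    thus ?thesis unfolding walsh_square[of f L, OF f] by auto
  qed
  \<comment> \<open>(n + s) / 2 need not be an integer, so absolute values are compared through
    their squares.\<close>
  have powr_sq: "(2 powr ((real n + real t) / 2))\<^sup>2 = 2 ^ (n + t)" for t :: nat
    by (simp add: powr_powr flip: powr_realpow powr_numeral)
  show ?thesis
  proof (intro iffI conjI)
    assume pl: "plateaued n s f"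
    thus "s \<le> n" by (simp add: plateaued_def)
    obtain b where b: "walsh n f b \<noteq> 0" using ex_walsh_nonzero by blast
    with pl have "\<bar>real_of_int (walsh n f b)\<bar> = 2 powr ((real n + real s) / 2)"
      by (auto simp: plateaued_def)
    hence "(real_of_int (walsh n f b))\<^sup>2 = 2 ^ (n + s)"
      using powr_sq[of s] by (metis power2_abs)
    hence "real_of_int ((walsh n f b)\<^sup>2) = real_of_int (2 ^ (n + s))"
      by simp
    hence "(walsh n f b)\<^sup>2 = 2 ^ (n + s)"
      by (simp only: of_int_eq_iff)
    hence "2 ^ n * int (card ?K) = 2 ^ n * 2 ^ s"
      using sq[of b] b by (simp add: power_add)
    hence "int (card ?K) = int (2 ^ s)"
      by simp
    thus "card ?K = 2 ^ s"
      by (simp only: of_nat_eq_iff)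
  next
    assume *: "s \<le> n \<and> card ?K = 2 ^ s"
    have "\<bar>real_of_int (walsh n f b)\<bar> = 0 \<or>
        \<bar>real_of_int (walsh n f b)\<bar> = 2 powr ((real n + real s) / 2)" for b
    proof (cases "walsh n f b = 0")
      case False
      hence "(walsh n f b)\<^sup>2 = 2 ^ (n + s)"
        using sq[of b] * by (simp add: power_add)
      hence "real_of_int ((walsh n f b)\<^sup>2) = 2 ^ (n + s)"
        by simp
      hence "\<bar>real_of_int (walsh n f b)\<bar>\<^sup>2 = (2 powr ((real n + real s) / 2))\<^sup>2"
        by (simp add: powr_sq)
      hence "\<bar>real_of_int (walsh n f b)\<bar> = 2 powr ((real n + real s) / 2)"
        by (rule power2_eq_imp_eq) simp_all
      thus ?thesis ..
    qed simp
    with * show "plateaued n s f"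
      by (auto simp: plateaued_def)
  qed
qed

end

text \<open>With n = 2h this is the operator in the polarisation of \<open>Q2\<close>: x^(n - i) is
  the adjoint of x^i under the trace form. The middle power is self-adjoint and occurs once, which
  matches the half trace in \<open>Q2\<close>.\<close>

definition palindrome_of :: "nat \<Rightarrow> (nat \<Rightarrow> bit) \<Rightarrow> bit poly" where
  "palindrome_of h a =
     (\<Sum>i = 1..h - 1. monom (a i) i + monom (a i) (2 * h - i)) + monom (a h) h"

section \<open>Polarisation of the second class\<close>

context binary_field
begin

text \<open>Expanding (x + u)^(2^i + 1) gives the cross terms x u^(2^i) and x^(2^i) u; Frobenius
  invariance of the trace turns the second into x u^(2^(n - i)).\<close>

lemma Q2_polarisation:
  assumes n: "n = 2 * h"
  shows "Q2 n a (x + u) = Q2 n a x + Q2 n a u + tr (x * lin (palindrome_of h a) (u :: 'a))"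
proof -
  let ?T = "abs_trace h :: 'a \<Rightarrow> bit"
  have h: "n div 2 = h" using n by simp
  have fixed: "(y ^ (2 ^ h)) ^ (2 ^ h) = y" for y :: 'a
    by (metis mult_2 n power_add power_card power_mult)
  have of_bit_T: "of_bit (?T y) = (\<Sum>i<h. y ^ (2 ^ i))" if "y ^ (2 ^ h) = y" for y
    using of_bit_abs_trace[OF char_2 that] .
  have T_add: "?T (y + z) = ?T y + ?T z" if "y ^ (2 ^ h) = y" "z ^ (2 ^ h) = z" for y z
    using that
    by (simp only: of_bit_inject[symmetric] of_bit_add of_bit_T add_power sum.distrib)
  \<comment> \<open>Transitivity of the trace: z + z^(2^h) is the relative trace to the subfield
    with \<open>2 ^ h\<close> elements.\<close>
  have T_trace: "?T (z + z ^ (2 ^ h)) = tr z" for z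
  proof -
    have "(z + z ^ (2 ^ h)) ^ (2 ^ h) = z + z ^ (2 ^ h)"
      by (simp only: add_power fixed add.commute)
    hence "of_bit (?T (z + z ^ (2 ^ h))) = (\<Sum>i<h. (z + z ^ (2 ^ h)) ^ (2 ^ i))"
      by (rule of_bit_T)
    also have "\<dots> = (\<Sum>i<h. z ^ (2 ^ i)) + (\<Sum>i<h. z ^ (2 ^ (i + h)))"
      by (simp add: add_power sum.distrib power_add mult.commute flip: power_mult)
    also have "\<dots> = (\<Sum>i<n. z ^ (2 ^ i))"
    proof -
      have "(\<Sum>i<h. z ^ (2 ^ (i + h))) = (\<Sum>i = h..<n. z ^ (2 ^ i))"
        by (rule sum.reindex_bij_witness[of _ "\<lambda>i. i - h" "\<lambda>i. i + h"]) (auto simp: n)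
      thus ?thesis
        using sum.atLeastLessThan_concat[of 0 h n "\<lambda>i. z ^ (2 ^ i)"]
        by (simp add: n atLeast0LessThan)
    qed
    finally show ?thesis by (simp only: of_bit_tr[symmetric] of_bit_inject)
  qed
  have expand: "of_bit c * (x + u) ^ (2 ^ i + 1) =
      of_bit c * x ^ (2 ^ i + 1) + of_bit c * u ^ (2 ^ i + 1) +
      (x * (of_bit c * u ^ (2 ^ i)) + of_bit c * x ^ (2 ^ i) * u)" for c i
    by (simp only: power_add power_one_right add_power distrib_left distrib_right)
       (simp only: ac_simps)
  \<comment> \<open>Moves the Frobenius power from x to u, up to an outer power that the trace
    ignores.\<close>
  have twist: "of_bit c * x ^ (2 ^ i) * u = (x * (of_bit c * u ^ (2 ^ (n - i)))) ^ (2 ^ i)"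
    if "i \<le> n" for c i
  proof -
    have "(u ^ (2 ^ (n - i))) ^ (2 ^ i) = u"
      using that by (simp add: power_card flip: power_mult power_add)
    thus ?thesis
      by (simp only: power_mult_distrib of_bit_power) (simp only: ac_simps)
  qed
  have summand: "tr (of_bit (a i) * (x + u) ^ (2 ^ i + 1)) =
      tr (of_bit (a i) * x ^ (2 ^ i + 1)) + tr (of_bit (a i) * u ^ (2 ^ i + 1)) +
      tr (x * lin (monom (a i) i + monom (a i) (n - i)) u)" if "i \<le> n" for i
    unfolding expand tr_add twist[OF that] tr_power lin_add lin_monom distrib_left by (rule refl)
  have "?T (of_bit (a h) * (x + u) ^ (2 ^ h + 1)) =
      ?T (of_bit (a h) * x ^ (2 ^ h + 1)) + ?T (of_bit (a h) * u ^ (2 ^ h + 1)) +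
      tr (x * lin (monom (a h) h) u)"
  proof -
    \<comment> \<open>The norm y^(2^h + 1) lies in the subfield, the domain on which
      \<open>abs_trace h\<close> is additive. The two cross terms of the middle summand form a
      relative trace ?z + ?z^(2^h).\<close>
    have norm: "(of_bit (a h) * y ^ (2 ^ h + 1)) ^ (2 ^ h) = of_bit (a h) * y ^ (2 ^ h + 1)" for y :: 'a
      by (simp only: power_mult_distrib of_bit_power power_add power_one_right fixed)
         (simp only: mult.commute)
    have "n - h = h" "h \<le> n" using n by auto
    let ?z = "x * (of_bit (a h) * u ^ (2 ^ h))"
    have e: "of_bit (a h) * (x + u) ^ (2 ^ h + 1) =
        of_bit (a h) * x ^ (2 ^ h + 1) + of_bit (a h) * u ^ (2 ^ h + 1) + (?z + ?z ^ (2 ^ h))"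
      using twist[OF \<open>h \<le> n\<close>] \<open>n - h = h\<close> by (simp only: expand)
    have "(?z + ?z ^ (2 ^ h)) ^ (2 ^ h) = ?z + ?z ^ (2 ^ h)"
      by (simp only: add_power fixed add.commute)
    moreover have "(of_bit (a h) * x ^ (2 ^ h + 1) + of_bit (a h) * u ^ (2 ^ h + 1)) ^ (2 ^ h) =
        of_bit (a h) * x ^ (2 ^ h + 1) + of_bit (a h) * u ^ (2 ^ h + 1)"
      by (simp only: add_power norm)
    ultimately show ?thesis
      by (simp only: e T_add norm T_trace lin_monom)
  qed
  moreover have "tr (\<Sum>i = 1..h - 1. of_bit (a i) * (x + u) ^ (2 ^ i + 1)) =
      tr (\<Sum>i = 1..h - 1. of_bit (a i) * x ^ (2 ^ i + 1)) +
      tr (\<Sum>i = 1..h - 1. of_bit (a i) * u ^ (2 ^ i + 1)) +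
      tr (x * lin (\<Sum>i = 1..h - 1. monom (a i) i + monom (a i) (n - i)) u)"
  proof -
    have "(\<Sum>i = 1..h - 1. tr (of_bit (a i) * (x + u) ^ (2 ^ i + 1))) =
        (\<Sum>i = 1..h - 1. tr (of_bit (a i) * x ^ (2 ^ i + 1)) + tr (of_bit (a i) * u ^ (2 ^ i + 1)) +
           tr (x * lin (monom (a i) i + monom (a i) (n - i)) u))"
      by (rule sum.cong[OF refl], rule summand) (auto simp: n)
    thus ?thesis
      unfolding tr_sum lin_sum sum_distrib_left by (simp only: sum.distrib)
  qed
  ultimately show ?thesis
    unfolding Q2_def palindrome_of_def h lin_add distrib_left tr_add n[symmetric]
    by (simp only: ac_simps)
qed

lemma plateaued_Q2_iff:
  assumes n: "n = 2 * h"
  shows "plateaued n s (Q2 n a :: 'a \<Rightarrow> bit) \<longleftrightarrow>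
    s \<le> n \<and> degree (gcd (palindrome_of h a) (monom 1 n + 1)) = s"
proof -
  have "plateaued n s (Q2 n a :: 'a \<Rightarrow> bit) \<longleftrightarrow>
    s \<le> n \<and> card {x. lin (palindrome_of h a) x = 0} = 2 ^ s"
    by (rule plateaued_iff) (rule Q2_polarisation[OF n] lin_add_right)+
  thus ?thesis by (simp add: card_lin_kernel)
qed

end

section \<open>Palindromes\<close>

lemma UNIV_bit: "(UNIV :: bit set) = {0, 1}"
  by (auto intro: bit.exhaust)

lemma finite_UNIV_bit [simp]: "finite (UNIV :: bit set)"
  by (simp add: UNIV_bit)

text \<open>The centre of symmetry is fixed by N and not by the degree of A, so 0 and polynomials
  with further vanishing end coefficients belong to the set.\<close>

definition palindromes :: "nat \<Rightarrow> bit poly set" where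
  "palindromes N = {A. degree A \<le> N \<and> coeff A 0 = 0 \<and> (\<forall>j\<le>N. coeff A (N - j) = coeff A j)}"

lemma coeff_palindrome_of:
  assumes "h > 0"
  shows "coeff (palindrome_of h a) j =
    (if j \<in> {1..h} then a j else if j \<in> {h<..<2 * h} then a (2 * h - j) else 0)"
proof -
  have "coeff (palindrome_of h a) j = (\<Sum>i = 1..h - 1. (if i = j then a i else 0)) +
      (\<Sum>i = 1..h - 1. (if 2 * h - i = j then a i else 0)) + (if h = j then a h else 0)"
    by (simp add: palindrome_of_def coeff_sum sum.distrib)
  also have "(\<Sum>i = 1..h - 1. (if 2 * h - i = j then a i else 0)) =
      (\<Sum>i = 1..h - 1. (if i = 2 * h - j then (if h < j then a i else 0) else 0))"
    by (rule sum.cong) auto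
  finally show ?thesis
    using assms by (auto simp: sum.delta)
qed

lemma bij_betw_palindrome_of:
  assumes "h > 0"
  shows "bij_betw (palindrome_of h) ({1..h} \<rightarrow>\<^sub>E UNIV) (palindromes (2 * h))"
  unfolding bij_betw_def
proof
  note coeff = coeff_palindrome_of[OF assms]
  show "inj_on (palindrome_of h) ({1..h} \<rightarrow>\<^sub>E UNIV)"
  proof (rule inj_onI)
    fix a b assume ab: "a \<in> {1..h} \<rightarrow>\<^sub>E (UNIV :: bit set)" "b \<in> {1..h} \<rightarrow>\<^sub>E (UNIV :: bit set)"
      and eq: "palindrome_of h a = palindrome_of h b"
    have "a i = b i" if "i \<in> {1..h}" for i
      using coeff[of a i] coeff[of b i] that eq by simp
    thus "a = b" by (rule PiE_ext[OF ab])
  qed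
  show "palindrome_of h ` ({1..h} \<rightarrow>\<^sub>E UNIV) = palindromes (2 * h)"
  proof (intro equalityI subsetI)
    fix A assume "A \<in> palindrome_of h ` ({1..h} \<rightarrow>\<^sub>E UNIV)"
    then obtain a where A: "A = palindrome_of h a" by blast
    have "degree A \<le> 2 * h"
      by (rule degree_le) (auto simp: A coeff)
    thus "A \<in> palindromes (2 * h)"
      by (auto simp: palindromes_def A coeff intro!: arg_cong[where f = a])
  next
    fix A assume A: "A \<in> palindromes (2 * h)"
    have "coeff A j = coeff (palindrome_of h (restrict (coeff A) {1..h})) j" for j
    proof (cases "j < 2 * h")
      case True
      thus ?thesis
        using A by (auto simp: coeff palindromes_def not_le)
    next
      case False
      \<comment> \<open>The top coefficient mirrors the vanishing constant term.\<close>
      have "coeff A (2 * h) = 0"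
        using A by (auto simp: palindromes_def dest: spec[of _ 0])
      hence "coeff A j = 0"
        using False A by (cases "j = 2 * h") (auto simp: palindromes_def intro!: coeff_eq_0)
      thus ?thesis using False assms by (auto simp: coeff)
    qed
    hence "A = palindrome_of h (restrict (coeff A) {1..h})"
      by (simp add: poly_eq_iff)
    thus "A \<in> palindrome_of h ` ({1..h} \<rightarrow>\<^sub>E UNIV)"
      by (rule image_eqI[where f = "palindrome_of h"]) auto
  qed
qed

lemma palindromes_0: "palindromes 0 = {0}"
  by (auto simp: palindromes_def dest: degree_0_id)

lemma finite_palindromes [simp]: "finite (palindromes (2 * h))"
  and card_palindromes: "card (palindromes (2 * h)) = 2 ^ h"
proof -
  have "finite (palindromes (2 * h)) \<and> card (palindromes (2 * h)) = 2 ^ h"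
  proof (cases "h = 0")
    case False
    hence bij: "bij_betw (palindrome_of h) ({1..h} \<rightarrow>\<^sub>E UNIV) (palindromes (2 * h))"
      by (intro bij_betw_palindrome_of) simp
    have "finite ({1..h} \<rightarrow>\<^sub>E (UNIV :: bit set))" "card ({1..h} \<rightarrow>\<^sub>E (UNIV :: bit set)) = 2 ^ h"
      by (auto intro!: finite_PiE simp: card_PiE UNIV_bit numeral_2_eq_2)
    thus ?thesis
      using bij_betw_finite[OF bij] bij_betw_same_card[OF bij] by simp
  qed (simp add: palindromes_0)
  thus "finite (palindromes (2 * h))" "card (palindromes (2 * h)) = 2 ^ h" by auto
qed

text \<open>Expresses the symmetry through the multiplicative \<open>reflect_poly\<close>. As that
  reflects about the degree of A, a power of x restores the centre N/2.\<close>

lemma palindromes_iff: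
  "A \<in> palindromes N \<longleftrightarrow>
    degree A \<le> N \<and> coeff A 0 = 0 \<and> monom 1 (N - degree A) * reflect_poly A = A"
proof (cases "degree A \<le> N")
  case True
  have "coeff (monom 1 (N - degree A) * reflect_poly A) j =
      (if j \<le> N then coeff A (N - j) else 0)" for j
  proof -
    have "degree A - (j - (N - degree A)) = N - j" if "N - degree A \<le> j" "j \<le> N"
      using that True by simp
    thus ?thesis
      using True by (auto simp: coeff_monom_mult coeff_reflect_poly coeff_eq_0)
  qed
  moreover have "coeff A j = 0" if "\<not> j \<le> N" for j
    using that True by (simp add: coeff_eq_0)
  ultimately show ?thesis
    using True unfolding palindromes_def poly_eq_iff by auto
qed (auto simp: palindromes_def)

text \<open>Reflection preserves divisibility, and a palindrome is a monomial multiple of its own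
  reflection.\<close>

lemma reflect_poly_dvd_palindrome:
  assumes "A \<in> palindromes N" "d dvd A"
  shows "reflect_poly d dvd A"
proof -
  from \<open>d dvd A\<close> obtain h where "A = d * h" ..
  hence "reflect_poly d dvd reflect_poly A"
    by (simp add: reflect_poly_mult)
  thus ?thesis
    using assms(1) by (metis dvd_mult palindromes_iff)
qed

text \<open>A self-reciprocal d factors out of the reflection and cancels from the symmetry
  equation; its nonzero constant term transfers the condition at 0 to h.\<close>

lemma mult_palindrome_iff:
  assumes d: "self_reciprocal d" and deg: "degree d \<le> N"
  shows "d * h \<in> palindromes N \<longleftrightarrow> h \<in> palindromes (N - degree d)"
proof (cases "h = 0")
  case False
  have "d \<noteq> 0" "coeff d 0 \<noteq> 0" "reflect_poly d = d"
    using d by (auto simp: self_reciprocal_def)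
  have "degree (d * h) = degree d + degree h"
    using \<open>d \<noteq> 0\<close> False by (rule degree_mult_eq)
  moreover have "monom 1 k * reflect_poly (d * h) = d * h \<longleftrightarrow> monom 1 k * reflect_poly h = h" for k
  proof -
    have "monom 1 k * reflect_poly (d * h) = d * (monom 1 k * reflect_poly h)"
      by (simp add: reflect_poly_mult \<open>reflect_poly d = d\<close> mult.left_commute)
    thus ?thesis using \<open>d \<noteq> 0\<close> by (metis mult_cancel_left)
  qed
  ultimately show ?thesis
    using \<open>coeff d 0 \<noteq> 0\<close> deg by (auto simp: palindromes_iff coeff_mult_0 diff_diff_eq)
qed (simp add: palindromes_def)

text \<open>Division by d is a bijection onto the palindromes of length parameter
  \<open>N - degree d\<close>.\<close>

lemma card_palindromes_dvd:
  assumes d: "self_reciprocal d" and deg: "degree d \<le> N" and ev: "even N" "even (degree d)"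
  shows "card {A \<in> palindromes N. d dvd A} = 2 ^ ((N - degree d) div 2)"
proof -
  have "d \<noteq> 0" using d by (auto simp: self_reciprocal_def)
  have "{A \<in> palindromes N. d dvd A} = (*) d ` palindromes (N - degree d)"
    by (auto simp: mult_palindrome_iff[OF d deg] elim!: dvdE)
  moreover have "inj_on ((*) d) X" for X
    using \<open>d \<noteq> 0\<close> by (auto intro: inj_onI)
  ultimately have "card {A \<in> palindromes N. d dvd A} = card (palindromes (N - degree d))"
    by (simp add: card_image)
  also have "N - degree d = 2 * ((N - degree d) div 2)"
    using ev by simp
  finally show ?thesis
    by (simp only: card_palindromes)
qed

section \<open>Prime self-reciprocal factors\<close>

lemma neg_one_bit_poly: "[:- 1, 1:] = ([:1, 1:] :: bit poly)"
  by simp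

lemma add_power_bit_poly: "(p + q) ^ (2 ^ v) = p ^ (2 ^ v) + (q :: bit poly) ^ (2 ^ v)"
proof (induction v)
  case (Suc v)
  have sq: "(p + q)\<^sup>2 = p\<^sup>2 + q\<^sup>2" for p q :: "bit poly"
  proof -
    have "(p + q)\<^sup>2 = p\<^sup>2 + q\<^sup>2 + (p * q + p * q)"
      by (simp only: power2_eq_square distrib_left distrib_right ac_simps)
    thus ?thesis by simp
  qed
  show ?case
    using Suc sq by (simp add: power_mult mult.commute[of 2])
qed simp

text \<open>Injectivity of Frobenius powers, used to extract x^m + 1 from x^n + 1.\<close>

lemma power_eq_bit_poly:
  assumes "p ^ (2 ^ v) = (q :: bit poly) ^ (2 ^ v)"
  shows "p = q"
proof -
  have "(p + q) ^ (2 ^ v) = 0"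
    using assms by (simp add: add_power_bit_poly)
  hence "p + q = 0" by simp
  moreover have "p = p + q + q"
    by (simp only: add.assoc) simp
  ultimately show ?thesis by simp
qed

text \<open>At 1 the mirrored terms cancel in pairs and only the middle coefficient
  survives.\<close>

lemma x_plus_1_dvd_palindrome_iff:
  assumes "h > 0" "A \<in> palindromes (2 * h)"
  shows "[:1, 1:] dvd A \<longleftrightarrow> coeff A h = 0"
proof -
  obtain a where A: "A = palindrome_of h a"
    using assms bij_betw_palindrome_of[of h] unfolding bij_betw_def by blast
  have "poly A 1 = a h"
    by (simp add: A palindrome_of_def poly_sum poly_monom)
  also have "a h = coeff A h"
    using assms(1) by (simp add: A coeff_palindrome_of)
  finally show ?thesis
    using poly_eq_0_iff_dvd[of A 1] by simp
qed

text \<open>The mirrored terms of exponents i and 2h - i contribute i c + (2h - i) c = 2h c = 0 to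
  the derivative at 1, so a root at 1 is at least double. Hence (x + 1)^2 serves as one
  prime.\<close>

lemma x_plus_1_square_dvd_palindrome:
  assumes A: "A \<in> palindromes (2 * h)" and dvd: "[:1, 1:] dvd A"
  shows "[:1, 1:]\<^sup>2 dvd A"
proof (cases "h = 0")
  case True
  thus ?thesis using A by (simp add: palindromes_0)
next
  case False
  hence "h > 0" by simp
  then obtain a where a: "A = palindrome_of h a"
    using A bij_betw_palindrome_of[of h] unfolding bij_betw_def by blast
  have "a h = 0"
    using x_plus_1_dvd_palindrome_iff[OF \<open>h > 0\<close> A] dvd False by (simp add: a coeff_palindrome_of)
  have pair: "of_nat i * c + of_nat (2 * h - i) * c = 0" if "i \<le> h" for i and c :: bit
  proof -
    have "of_nat i * c + of_nat (2 * h - i) * c = of_nat (2 * h) * c"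
      using that by (simp only: distrib_right[symmetric] of_nat_add[symmetric]) simp
    thus ?thesis by simp
  qed
  have pderiv_sum: "pderiv (\<Sum>j\<in>J. g j) = (\<Sum>j\<in>J. pderiv (g j))"
    for J :: "nat set" and g :: "nat \<Rightarrow> bit poly"
    by (induction J rule: infinite_finite_induct) (simp_all add: pderiv_add)
  have "poly (pderiv A) 1 = (\<Sum>i = 1..h - 1. of_nat i * a i + of_nat (2 * h - i) * a i)"
    by (simp add: a palindrome_of_def pderiv_add pderiv_sum pderiv_monom poly_sum poly_monom
        \<open>a h = 0\<close>)
  also have "\<dots> = 0"
    by (rule sum.neutral) (auto intro!: pair)
  finally have "poly (pderiv A) 1 = 0" .
  moreover obtain g where g: "A = [:1, 1:] * g" using dvd ..
  hence "pderiv A = [:1, 1:] * pderiv g + g"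
    by (simp only: pderiv_mult) (simp add: pderiv_pCons)
  ultimately have "poly g 1 = 0" by simp
  hence "[:1, 1:] dvd g"
    by (simp only: poly_eq_0_iff_dvd neg_one_bit_poly)
  thus ?thesis unfolding g power2_eq_square by (rule mult_dvd_mono[OF dvd_refl])
qed

text \<open>A repeated factor divides the derivative. For odd m, x times the derivative is x^m, so
  the factor divides both x^m and x^m + 1.\<close>

lemma squarefree_x_m_plus_1:
  assumes "odd m"
  shows "squarefree (monom 1 m + 1 :: bit poly)"
proof (rule squarefreeI)
  fix p :: "bit poly" assume "p\<^sup>2 dvd monom 1 m + 1"
  then obtain q where "monom 1 m + 1 = p\<^sup>2 * q" ..
  hence q: "monom 1 m + 1 = p * (p * q)"
    by (simp only: power2_eq_square mult.assoc)
  have "p dvd pderiv (p * (p * q))"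
    by (simp add: pderiv_mult)
  hence "p dvd monom 1 1 * pderiv (monom 1 m + 1)"
    by (simp add: q)
  also have "monom 1 1 * pderiv (monom 1 m + 1) = (monom 1 m :: bit poly)"
  proof -
    obtain k where "m = 2 * k + 1" using assms by (rule oddE)
    hence "m > 0" "of_nat m = (1 :: bit)" by simp_all
    thus ?thesis by (simp add: pderiv_add pderiv_monom mult_monom)
  qed
  finally have "p dvd monom 1 m" .
  moreover have "p dvd monom 1 m + 1" by (simp add: q)
  ultimately show "p dvd 1" by (metis dvd_add_right_iff)
qed

lemma coprime_if_squarefree_mult: "squarefree (a * b) \<Longrightarrow> coprime a b"
  by (rule coprimeI) (metis mult_dvd_mono power2_eq_square squarefreeD)

text \<open>The property of \<open>p\<close> that turns the gcd of a palindrome with a product of powers of such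
  polynomials into a product of powers of the same polynomials.\<close>

definition palindromic_prime :: "bit poly \<Rightarrow> bool" where
  "palindromic_prime p \<longleftrightarrow> self_reciprocal p \<and> even (degree p) \<and>
     (\<forall>q h B. prime q \<longrightarrow> q dvd p \<longrightarrow> B \<in> palindromes (2 * h) \<longrightarrow> q dvd B \<longrightarrow> p dvd B)"

lemma irreducible_dvd_imp_dvd:
  assumes "irreducible p" "q dvd p" "\<not> is_unit q"
  shows "p dvd q"
  using assms by (meson irreducibleD')

lemma palindromic_prime_x_plus_1_square: "palindromic_prime ([:1, 1:]\<^sup>2)"
  unfolding palindromic_prime_def self_reciprocal_def
proof (intro conjI allI impI)
  have "reflect_poly [:1, 1 :: bit:] = [:1, 1:]"
    by (simp add: reflect_poly_pCons)
  thus "reflect_poly ([:1, 1 :: bit:]\<^sup>2) = [:1, 1:]\<^sup>2"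
    by (simp only: reflect_poly_power)
  show "coeff ([:1, 1 :: bit:]\<^sup>2) 0 \<noteq> 0"
    by (simp add: power2_eq_square)
  show "even (degree ([:1, 1 :: bit:]\<^sup>2))"
    by (simp add: degree_power_eq)
next
  fix q B :: "bit poly" and h
  assume q: "prime q" "q dvd [:1, 1:]\<^sup>2" and B: "B \<in> palindromes (2 * h)" "q dvd B"
  have "irreducible [:1, 1 :: bit:]"
    by (rule irreducible_linear_field_poly) simp
  moreover have "q dvd [:1, 1:]" "\<not> is_unit q"
    using q prime_dvd_power by auto
  ultimately have "[:1, 1:] dvd q"
    by (rule irreducible_dvd_imp_dvd)
  thus "[:1, 1:]\<^sup>2 dvd B"
    using x_plus_1_square_dvd_palindrome[OF B(1)] B(2) dvd_trans by blast
qed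

text \<open>An irreducible p divides each of its prime divisors. If p = g g*, a prime divisor of p
  is divisible by g or its reflection is; the symmetry of B then yields both g and g*, which are
  coprime.\<close>

lemma palindromic_prime_if_prime_self_reciprocal:
  assumes p: "prime_self_reciprocal p" and deg: "even (degree p)"
  shows "palindromic_prime p"
  using p unfolding prime_self_reciprocal_def
proof (elim conjE disjE exE)
  assume irr: "irreducible p" and sr: "self_reciprocal p"
  show ?thesis
    unfolding palindromic_prime_def
  proof (intro conjI allI impI sr deg)
    fix q B :: "bit poly" assume "prime q" "q dvd p" "q dvd B"
    thus "p dvd B"
      using irreducible_dvd_imp_dvd[OF irr] by (meson dvd_trans not_prime_unit)
  qed
next
  fix u g
  assume "u \<noteq> 0" and g: "lead_coeff g = 1" "irreducible g" "coeff g 0 \<noteq> 0"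
    and not_assoc: "\<nexists>c. reflect_poly g = smult c g" and p_eq: "p = smult u (g * reflect_poly g)"
  \<comment> \<open>A nonzero u in the two-element field is 1.\<close>
  have p_eq: "p = g * reflect_poly g"
    using \<open>u \<noteq> 0\<close> p_eq by simp
  have rr: "reflect_poly (reflect_poly g) = g"
    using g(3) by (rule reflect_poly_reflect_poly)
  have "g \<noteq> 0" using g by auto
  \<comment> \<open>Since g and g* have equal degree, divisibility would make g* a constant multiple
    of g.\<close>
  have "\<not> g dvd reflect_poly g"
  proof
    assume "g dvd reflect_poly g"
    then obtain c where c: "reflect_poly g = g * c" ..
    hence "c \<noteq> 0" using \<open>g \<noteq> 0\<close> by (metis mult_zero_right reflect_poly_eq_0_iff)
    hence "degree c = 0"
      using degree_mult_eq[OF \<open>g \<noteq> 0\<close> \<open>c \<noteq> 0\<close>] degree_reflect_poly_eq[OF g(3)] c by simp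
    then obtain k where "c = [:k:]" by (rule degree_eq_zeroE)
    thus False using c not_assoc by (auto simp: mult.commute[of g])
  qed
  hence cop: "coprime g (reflect_poly g)"
    using field_poly_irreducible_imp_prime[OF g(2)] by (simp add: prime_elem_imp_coprime)
  have sr: "self_reciprocal p"
    using g by (auto simp: self_reciprocal_def p_eq reflect_poly_mult rr mult.commute coeff_mult_0)
  show ?thesis
    unfolding palindromic_prime_def
  proof (intro conjI allI impI sr deg)
    fix q B :: "bit poly" and h
    assume q: "prime q" "q dvd p" and B: "B \<in> palindromes (2 * h)" "q dvd B"
    have "g dvd B"
    proof (cases "q dvd g")
      case True
      thus ?thesis
        using irreducible_dvd_imp_dvd[OF g(2)] q(1) B(2) by (meson dvd_trans not_prime_unit)
    next
      case False
      hence "q dvd reflect_poly g"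
        using q prime_dvd_mult_iff unfolding p_eq by blast
      then obtain s where s: "reflect_poly g = q * s" ..
      \<comment> \<open>The constant term of g* is the leading coefficient of g, so q has a nonzero
        constant term and reflection keeps its degree; the reflection of q is thus a nonunit divisor
        of g.\<close>
      have "coeff q 0 * coeff s 0 = 1"
        using g(1) by (metis coeff_0_reflect_poly coeff_mult_0 s)
      hence "coeff q 0 \<noteq> 0" by (metis mult_zero_left zero_neq_one)
      hence "degree (reflect_poly q) = degree q" by simp
      moreover have "degree q \<noteq> 0"
        using q(1) by (metis is_unit_iff_degree not_prime_0 not_prime_unit)
      ultimately have "\<not> is_unit (reflect_poly q)"
        by (metis is_unit_iff_degree not_is_unit_0)
      moreover have "reflect_poly q dvd g"
        using arg_cong[OF s, of reflect_poly] by (simp add: rr reflect_poly_mult)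
      ultimately have "g dvd reflect_poly q"
        by (intro irreducible_dvd_imp_dvd[OF g(2)])
      thus ?thesis
        using reflect_poly_dvd_palindrome[OF B] dvd_trans by blast
    qed
    moreover from this have "reflect_poly g dvd B"
      by (rule reflect_poly_dvd_palindrome[OF B(1)])
    ultimately show "p dvd B"
      unfolding p_eq using cop by (rule divides_mult)
  qed
qed

section \<open>Counting palindromes by their gcd\<close>

text \<open>Inversion on a product of chains: by induction on the distance to the top corner N, all
  terms of the sum above e except that of e itself are already known to agree.\<close>

lemma upward_sums_determine:
  fixes f g :: "('i \<Rightarrow> nat) \<Rightarrow> int"
  assumes I: "finite I"
    and eq: "\<And>e. e \<in> (\<Pi>\<^sub>E i\<in>I. {..N i}) \<Longrightarrow>
      (\<Sum>e' | e' \<in> (\<Pi>\<^sub>E i\<in>I. {..N i}) \<and> (\<forall>i\<in>I. e i \<le> e' i). f e') =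
      (\<Sum>e' | e' \<in> (\<Pi>\<^sub>E i\<in>I. {..N i}) \<and> (\<forall>i\<in>I. e i \<le> e' i). g e')"
    and e: "e \<in> (\<Pi>\<^sub>E i\<in>I. {..N i})"
  shows "f e = g e"
  using e
proof (induction "\<Sum>i\<in>I. N i - e i" arbitrary: e rule: less_induct)
  case less
  let ?B = "\<Pi>\<^sub>E i\<in>I. {..N i}"
  let ?U = "{e'. e' \<in> ?B \<and> (\<forall>i\<in>I. e i \<le> e' i)}"
  have "finite ?B" using I by (intro finite_PiE) auto
  hence fin: "finite ?U" by simp
  have "e \<in> ?U" using less.prems by simp
  have "f e' = g e'" if e': "e' \<in> ?U - {e}" for e'
  proof (rule less.hyps)
    show "e' \<in> ?B" using e' by simp
    have "\<exists>i\<in>I. e i \<noteq> e' i"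
      using e' less.prems PiE_ext[of e I "\<lambda>i. {..N i}" e'] by auto
    then obtain i where i: "i \<in> I" "e i < e' i"
      using e' by (auto simp: le_less)
    show "(\<Sum>i\<in>I. N i - e' i) < (\<Sum>i\<in>I. N i - e i)"
    proof (rule sum_strict_mono_ex1[OF I])
      show "\<forall>i\<in>I. N i - e' i \<le> N i - e i" using e' by (auto intro: diff_le_mono2)
      have "e' i \<le> N i" using e' i by auto
      thus "\<exists>i\<in>I. N i - e' i < N i - e i" using i by (intro bexI[of _ i]) auto
    qed
  qed
  hence "(\<Sum>e'\<in>?U - {e}. f e') = (\<Sum>e'\<in>?U - {e}. g e')"
    by (rule sum.cong[OF refl])
  thus ?case
    using eq[OF less.prems] sum.remove[OF fin \<open>e \<in> ?U\<close>, of f] sum.remove[OF fin \<open>e \<in> ?U\<close>, of g]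
    by simp
qed

text \<open>Differences of consecutive powers, so that sums from e to N telescope to
  \<open>2 ^ ((N - e) * c)\<close>. The case e = N is separate because truncated subtraction would
  make the difference 0 there.\<close>

definition exponent_weight :: "nat \<Rightarrow> nat \<Rightarrow> nat \<Rightarrow> int" where
  "exponent_weight N c e = (if e = N then 1 else 2 ^ ((N - e) * c) - 2 ^ ((N - Suc e) * c))"

lemma sum_exponent_weight:
  assumes "e \<le> N"
  shows "(\<Sum>k = e..N. exponent_weight N c k) = 2 ^ ((N - e) * c)"
  using assms
proof (induction e rule: inc_induct)
  case (step e)
  have "(\<Sum>k = e..N. exponent_weight N c k) =
      exponent_weight N c e + (\<Sum>k = Suc e..N. exponent_weight N c k)"
    using step.hyps by (simp add: sum.atLeast_Suc_atMost)
  thus ?case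
    using step by (simp add: exponent_weight_def)
qed (simp add: exponent_weight_def)

lemma monom_sum: "monom (\<Prod>i\<in>I. c i) (\<Sum>i\<in>I. k i) = (\<Prod>i\<in>I. monom (c i :: 'b::comm_semiring_1) (k i))"
  by (induction I rule: infinite_finite_induct) (simp_all flip: mult_monom)

section \<open>Exponent vectors of palindromes relative to a factorisation\<close>

locale palindromic_factorisation =
  fixes I :: "'i set" and p :: "'i \<Rightarrow> bit poly" and N :: "'i \<Rightarrow> nat" and P :: "bit poly"
    and h :: nat
  assumes finite_I: "finite I"
    and palindromic_prime: "\<And>i. i \<in> I \<Longrightarrow> palindromic_prime (p i)"
    and coprime: "\<And>i j. i \<in> I \<Longrightarrow> j \<in> I \<Longrightarrow> i \<noteq> j \<Longrightarrow> coprime (p i) (p j)"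
    and P_eq: "P = (\<Prod>i\<in>I. p i ^ N i)"
    and degree_P: "degree P = 2 * h"
begin

lemma p_nonzero: "i \<in> I \<Longrightarrow> p i \<noteq> 0"
  using palindromic_prime[of i] by (auto simp: palindromic_prime_def self_reciprocal_def)

abbreviation box :: "('i \<Rightarrow> nat) set" where
  "box \<equiv> \<Pi>\<^sub>E i\<in>I. {..N i}"

lemma finite_box: "finite box"
  using finite_I by (intro finite_PiE) auto

definition prod_of :: "('i \<Rightarrow> nat) \<Rightarrow> bit poly" where
  "prod_of e = (\<Prod>i\<in>I. p i ^ e i)"

lemma degree_prod_of: "degree (prod_of e) = (\<Sum>i\<in>I. e i * degree (p i))"
  unfolding prod_of_def
  by (subst degree_prod_sum_eq) (auto simp: p_nonzero degree_power_eq intro!: sum.cong)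

lemma prod_of_nonzero: "prod_of e \<noteq> 0"
  using finite_I p_nonzero by (auto simp: prod_of_def)

lemma P_eq_prod_of: "P = prod_of N"
  by (simp add: P_eq prod_of_def)

lemma degree_diff:
  assumes "e \<in> box"
  shows "2 * h - degree (prod_of e) = (\<Sum>i\<in>I. (N i - e i) * degree (p i))"
proof -
  have "2 * h = degree (prod_of N)"
    by (simp add: degree_P[symmetric] P_eq_prod_of)
  also have "\<dots> - degree (prod_of e) = (\<Sum>i\<in>I. N i * degree (p i) - e i * degree (p i))"
    unfolding degree_prod_of using assms by (intro sum_subtractf_nat[symmetric]) auto
  finally show ?thesis by (simp only: diff_mult_distrib)
qed

lemma self_reciprocal_prod_of: "self_reciprocal (prod_of e)" "even (degree (prod_of e))"
proof -
  have sr: "reflect_poly (p i) = p i" "poly (p i) 0 \<noteq> 0" "even (degree (p i))" if "i \<in> I" for i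
    using palindromic_prime[OF that]
    by (auto simp: palindromic_prime_def self_reciprocal_def poly_0_coeff_0)
  have "reflect_poly (prod_of e) = prod_of e"
    unfolding prod_of_def reflect_poly_prod reflect_poly_power by (rule prod.cong) (auto simp: sr)
  moreover have "poly (prod_of e) 0 \<noteq> 0"
    unfolding prod_of_def poly_prod using finite_I sr(2) by (auto simp: poly_power)
  ultimately show "self_reciprocal (prod_of e)"
    by (simp add: self_reciprocal_def poly_0_coeff_0)
  show "even (degree (prod_of e))"
    unfolding degree_prod_of using sr(3) by (intro dvd_sum) auto
qed

text \<open>The cap at \<open>N i\<close> makes this the exponent in the gcd with P and keeps the
  maximum finite also for A = 0.\<close>

definition expo :: "bit poly \<Rightarrow> 'i \<Rightarrow> nat" where
  "expo A = (\<lambda>i\<in>I. Max {e. e \<le> N i \<and> p i ^ e dvd A})"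

lemma expo_Max:
  assumes "i \<in> I"
  shows "expo A i \<le> N i" "p i ^ expo A i dvd A"
proof -
  have "expo A i \<in> {e. e \<le> N i \<and> p i ^ e dvd A}"
    unfolding expo_def restrict_apply'[OF assms]
    by (rule Max_in) (auto intro: exI[of _ 0])
  thus "expo A i \<le> N i" "p i ^ expo A i dvd A" by auto
qed

lemma power_dvd_iff:
  assumes "i \<in> I" "e \<le> N i"
  shows "p i ^ e dvd A \<longleftrightarrow> e \<le> expo A i"
proof
  assume "p i ^ e dvd A"
  thus "e \<le> expo A i"
    unfolding expo_def restrict_apply'[OF assms(1)] using assms(2) by (intro Max_ge) auto
next
  assume "e \<le> expo A i"
  thus "p i ^ e dvd A"
    using expo_Max(2)[OF assms(1), of A] by (meson dvd_trans le_imp_power_dvd)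
qed

lemma expo_in_box: "expo A \<in> box"
  using expo_Max(1) by (auto simp: expo_def PiE_def extensional_def)

lemma prod_of_dvd:
  assumes "\<And>i. i \<in> I \<Longrightarrow> p i ^ e i dvd A"
  shows "prod_of e dvd A"
proof -
  have "J \<subseteq> I \<Longrightarrow> (\<Prod>i\<in>J. p i ^ e i) dvd A" if "finite J" for J
    using that
  proof (induction J)
    case (insert j J)
    have "coprime (p j ^ e j) (\<Prod>i\<in>J. p i ^ e i)"
    proof (rule prod_coprime_right)
      fix i assume "i \<in> J"
      hence "coprime (p j) (p i)"
        using insert by (intro coprime) auto
      thus "coprime (p j ^ e j) (p i ^ e i)" by simp
    qed
    thus ?case
      using insert assms by (auto intro: divides_mult)
  qed simp
  thus ?thesis using finite_I by (simp add: prod_of_def)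
qed

lemma prod_of_dvd_iff:
  assumes "e \<in> box"
  shows "prod_of e dvd A \<longleftrightarrow> (\<forall>i\<in>I. e i \<le> expo A i)"
proof
  assume dvd: "prod_of e dvd A"
  show "\<forall>i\<in>I. e i \<le> expo A i"
  proof
    fix i assume i: "i \<in> I"
    have "p i ^ e i dvd prod_of e"
      unfolding prod_of_def by (rule dvd_prodI[OF finite_I i])
    hence "p i ^ e i dvd A" using dvd by (rule dvd_trans)
    thus "e i \<le> expo A i" using assms i by (simp add: power_dvd_iff PiE_iff)
  qed
next
  assume "\<forall>i\<in>I. e i \<le> expo A i"
  thus "prod_of e dvd A"
    using assms by (intro prod_of_dvd) (auto simp: power_dvd_iff PiE_iff)
qed

text \<open>Dividing A by D leaves a palindrome B. A prime dividing both B and the cofactor Q of D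
  in P would divide some \<open>p i\<close>, so all of \<open>p i\<close> would divide B and the
  exponent of \<open>p i\<close> in A would be larger. Hence B and Q are coprime.\<close>

lemma degree_gcd_palindrome:
  assumes A: "A \<in> palindromes (2 * h)"
  shows "degree (gcd A P) = degree (prod_of (expo A))"
proof -
  define D where "D = prod_of (expo A)"
  define Q where "Q = prod_of (\<lambda>i. N i - expo A i)"
  have "D dvd A"
    unfolding D_def by (subst prod_of_dvd_iff[OF expo_in_box]) simp
  then obtain B where B: "A = D * B" ..
  have P: "P = D * Q"
    unfolding P_eq_prod_of D_def Q_def prod_of_def prod.distrib[symmetric]
    by (rule prod.cong) (auto simp: expo_Max(1) simp flip: power_add)
  have nz: "D \<noteq> 0" "Q \<noteq> 0" unfolding D_def Q_def by (rule prod_of_nonzero)+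
  have deg: "degree D \<le> 2 * h"
    using degree_P degree_mult_eq[OF nz] by (simp add: P)
  have sr: "self_reciprocal D" "even (degree D)"
    unfolding D_def by (rule self_reciprocal_prod_of)+
  have "B \<in> palindromes (2 * h - degree D)"
    using A mult_palindrome_iff[OF sr(1) deg] B by simp
  moreover have "2 * h - degree D = 2 * ((2 * h - degree D) div 2)"
    using sr(2) by simp
  ultimately have pal: "B \<in> palindromes (2 * ((2 * h - degree D) div 2))"
    by simp
  have "coprime B Q"
  proof (rule ccontr)
    assume "\<not> coprime B Q"
    then obtain q where q: "prime q" "q dvd gcd B Q"
      using prime_divisor_exists[of "gcd B Q"] nz by (auto simp: is_unit_gcd_iff)
    then obtain i where i: "i \<in> I" "q dvd p i ^ (N i - expo A i)"
      using finite_I by (auto simp: Q_def prod_of_def prime_dvd_prod_iff)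
    \<comment> \<open>Otherwise the exponent in Q is 0 and the prime q would divide 1.\<close>
    have lt: "expo A i < N i"
      using i(2) q(1) by (cases "expo A i < N i") auto
    have "q dvd p i" using i(2) q(1) prime_dvd_power by blast
    hence "p i dvd B"
      using palindromic_prime[OF i(1)] pal q unfolding palindromic_prime_def by auto
    moreover have "p i ^ expo A i dvd D"
      unfolding D_def prod_of_def by (rule dvd_prodI[OF finite_I i(1)])
    ultimately have "p i ^ Suc (expo A i) dvd A"
      unfolding B power_Suc2 by (intro mult_dvd_mono)
    hence "Suc (expo A i) \<le> expo A i"
      using power_dvd_iff[OF i(1)] lt by (simp only: Suc_le_eq)
    thus False by simp
  qed
  hence "gcd A P = normalize D"
    by (simp add: B P gcd_mult_left)
  moreover have "degree (normalize D) = degree D"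
    using nz by (intro order.antisym dvd_imp_degree_le) simp_all
  ultimately show ?thesis by (simp add: D_def)
qed

text \<open>Both sides have the same upward sums: on the left they count the palindromes divisible
  by \<open>prod_of e\<close>, on the right they are products of telescoping sums.\<close>

lemma card_expo_eq:
  assumes e: "e \<in> box"
  shows "int (card {A \<in> palindromes (2 * h). expo A = e}) =
    (\<Prod>i\<in>I. exponent_weight (N i) (degree (p i) div 2) (e i))"
proof (rule upward_sums_determine[OF finite_I _ e])
  fix e assume e: "e \<in> box"
  let ?U = "{e'. e' \<in> box \<and> (\<forall>i\<in>I. e i \<le> e' i)}"
  let ?S = "{A \<in> palindromes (2 * h). prod_of e dvd A}"
  have "(\<Sum>e'\<in>?U. int (card {A \<in> palindromes (2 * h). expo A = e'})) =
      (\<Sum>e'\<in>?U. \<Sum>A | A \<in> ?S \<and> expo A = e'. 1)"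
  proof (rule sum.cong[OF refl])
    fix e' assume "e' \<in> ?U"
    hence "{A \<in> palindromes (2 * h). expo A = e'} = {A. A \<in> ?S \<and> expo A = e'}"
      using prod_of_dvd_iff[OF e] by auto
    thus "int (card {A \<in> palindromes (2 * h). expo A = e'}) = (\<Sum>A | A \<in> ?S \<and> expo A = e'. 1)"
      by simp
  qed
  also have "\<dots> = (\<Sum>A\<in>?S. 1)"
    by (rule sum.group) (use expo_in_box prod_of_dvd_iff[OF e] finite_box in auto)
  also have "\<dots> = 2 ^ ((2 * h - degree (prod_of e)) div 2)"
  proof -
    have "prod_of e dvd prod_of N"
      unfolding prod_of_def using e by (intro prod_dvd_prod le_imp_power_dvd) auto
    hence "degree (prod_of e) \<le> 2 * h"
      using dvd_imp_degree_le prod_of_nonzero degree_P P_eq_prod_of by metis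
    thus ?thesis
      by (simp add: card_palindromes_dvd self_reciprocal_prod_of)
  qed
  also have "(2 * h - degree (prod_of e)) div 2 = (\<Sum>i\<in>I. (N i - e i) * (degree (p i) div 2))"
  proof -
    have "(\<Sum>i\<in>I. (N i - e i) * degree (p i)) = 2 * (\<Sum>i\<in>I. (N i - e i) * (degree (p i) div 2))"
      unfolding sum_distrib_left
    proof (rule sum.cong[OF refl])
      fix i assume "i \<in> I"
      hence "even (degree (p i))" using palindromic_prime by (simp add: palindromic_prime_def)
      thus "(N i - e i) * degree (p i) = 2 * ((N i - e i) * (degree (p i) div 2))"
        by (simp add: mult.left_commute)
    qed
    thus ?thesis by (simp add: degree_diff[OF e])
  qed
  also have "2 ^ \<dots> = (\<Prod>i\<in>I. \<Sum>k = e i..N i. exponent_weight (N i) (degree (p i) div 2) k)"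
    unfolding power_sum using e by (intro prod.cong) (auto simp: sum_exponent_weight PiE_iff)
  also have "\<dots> = (\<Sum>e'\<in>(\<Pi>\<^sub>E i\<in>I. {e i..N i}).
      \<Prod>i\<in>I. exponent_weight (N i) (degree (p i) div 2) (e' i))"
    by (rule prod_sum_PiE[OF finite_I]) simp
  also have "(\<Pi>\<^sub>E i\<in>I. {e i..N i}) = ?U"
    by (auto simp: PiE_iff extensional_def)
  finally show "(\<Sum>e'\<in>?U. int (card {A \<in> palindromes (2 * h). expo A = e'})) =
      (\<Sum>e'\<in>?U. \<Prod>i\<in>I. exponent_weight (N i) (degree (p i) div 2) (e' i))" .
qed

text \<open>Grouping by \<open>expo\<close> makes both the count and the degree split over I, so the
  sum becomes a product. The sets \<open>T i\<close> restrict the exponents so that one computation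
  serves both classes.\<close>

lemma gcd_degree_generating_function:
  assumes T: "\<And>i. i \<in> I \<Longrightarrow> T i \<subseteq> {..N i}"
  shows "(\<Sum>A | A \<in> palindromes (2 * h) \<and> (\<forall>i\<in>I. expo A i \<in> T i).
      monom (1 :: int) (2 * h - degree (gcd A P))) =
    (\<Prod>i\<in>I. \<Sum>e\<in>T i. monom (exponent_weight (N i) (degree (p i) div 2) e) ((N i - e) * degree (p i)))"
proof -
  let ?S = "{A. A \<in> palindromes (2 * h) \<and> (\<forall>i\<in>I. expo A i \<in> T i)}"
  let ?F = "\<lambda>A. monom (1 :: int) (2 * h - degree (gcd A P))"
  have box: "e \<in> box" if "e \<in> (\<Pi>\<^sub>E i\<in>I. T i)" for e
    using that T by (force simp: PiE_iff)
  have finT: "finite (\<Pi>\<^sub>E i\<in>I. T i)"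
    using finite_I finite_subset[OF T] by (intro finite_PiE) auto
  have "(\<Sum>A\<in>?S. ?F A) = (\<Sum>e\<in>(\<Pi>\<^sub>E i\<in>I. T i). \<Sum>A | A \<in> ?S \<and> expo A = e. ?F A)"
    by (rule sum.group[symmetric]) (use finT expo_in_box in \<open>auto simp: PiE_iff extensional_def\<close>)
  also have "\<dots> = (\<Sum>e\<in>(\<Pi>\<^sub>E i\<in>I. T i). \<Prod>i\<in>I.
      monom (exponent_weight (N i) (degree (p i) div 2) (e i)) ((N i - e i) * degree (p i)))"
  proof (rule sum.cong[OF refl])
    fix e assume e: "e \<in> (\<Pi>\<^sub>E i\<in>I. T i)"
    have S: "{A. A \<in> ?S \<and> expo A = e} = {A \<in> palindromes (2 * h). expo A = e}"
      using e by (auto simp: PiE_iff)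
    have "(\<Sum>A | A \<in> ?S \<and> expo A = e. ?F A) =
        (\<Sum>A\<in>{A \<in> palindromes (2 * h). expo A = e}. monom 1 (2 * h - degree (prod_of e)))"
      unfolding S by (rule sum.cong) (auto simp: degree_gcd_palindrome)
    also have "\<dots> = of_nat (card {A \<in> palindromes (2 * h). expo A = e}) *
        monom 1 (2 * h - degree (prod_of e))"
      by simp
    also have "\<dots> = monom (int (card {A \<in> palindromes (2 * h). expo A = e}))
        (2 * h - degree (prod_of e))"
      by (simp add: of_nat_poly smult_monom)
    finally show "(\<Sum>A | A \<in> ?S \<and> expo A = e. ?F A) = (\<Prod>i\<in>I.
        monom (exponent_weight (N i) (degree (p i) div 2) (e i)) ((N i - e i) * degree (p i)))"
      by (simp only: card_expo_eq[OF box[OF e]] degree_diff[OF box[OF e]] monom_sum)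
  qed
  also have "\<dots> = (\<Prod>i\<in>I. \<Sum>e\<in>T i.
      monom (exponent_weight (N i) (degree (p i) div 2) e) ((N i - e) * degree (p i)))"
    using finite_subset[OF T] by (intro prod_sum_PiE[symmetric] finite_I) auto
  finally show ?thesis .
qed

end

section \<open>The two generating functions\<close>

text \<open>The substitution j = M - e, with the term e = M giving the constant 1. The lower end a
  is later 0 or 1, according to the class.\<close>

lemma sum_monom_exponent_weight:
  assumes "a \<le> M"
  shows "(\<Sum>e = a..M. monom (exponent_weight M c e) ((M - e) * d)) =
    1 + (\<Sum>j = 1..M - a. monom (2 ^ (j * c) - 2 ^ ((j - 1) * c)) (j * d))"
proof -
  have "(\<Sum>e = a..M. monom (exponent_weight M c e) ((M - e) * d)) =
      (\<Sum>j = 0..M - a. monom (exponent_weight M c (M - j)) (j * d))"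
    by (rule sum.reindex_bij_witness[of _ "\<lambda>j. M - j" "\<lambda>e. M - e"]) (use assms in auto)
  also have "\<dots> = monom (exponent_weight M c M) 0 +
      (\<Sum>j = 1..M - a. monom (exponent_weight M c (M - j)) (j * d))"
    by (subst sum.atLeast_Suc_atMost) simp_all
  also have "(\<Sum>j = 1..M - a. monom (exponent_weight M c (M - j)) (j * d)) =
      (\<Sum>j = 1..M - a. monom (2 ^ (j * c) - 2 ^ ((j - 1) * c)) (j * d))"
  proof (rule sum.cong[OF refl])
    fix j assume j: "j \<in> {1..M - a}"
    hence "M - (M - j) = j" "M - Suc (M - j) = j - 1" "M - j \<noteq> M" by auto
    thus "monom (exponent_weight M c (M - j)) (j * d) =
        monom (2 ^ (j * c) - 2 ^ ((j - 1) * c)) (j * d)"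
      by (simp only: exponent_weight_def if_False)
  qed
  finally show ?thesis
    by (simp add: exponent_weight_def monom_0 flip: one_pCons)
qed

lemma prod_atMost_split_first: "(\<Prod>i = 0..k. F i) = F 0 * (\<Prod>i = 1..k. F i)" for k :: nat
  by (simp add: prod.atLeast_Suc_atMost)

lemma bij_betw_Collect:
  assumes "bij_betw f S T"
  shows "bij_betw f {x \<in> S. R (f x)} {y \<in> T. R y}"
  using assms by (auto simp: bij_betw_def inj_on_def)

section \<open>From counts of plateaued functions to counts of palindromes\<close>

context binary_field
begin

text \<open>For n = 2h the index range of \<open>Q1\<close> stops at h - 1, so only the half-trace
  term of \<open>Q2\<close> has to be switched off.\<close>

lemma Q1_eq_Q2:
  assumes n: "n = 2 * h" and "h > 0"
  shows "Q1 n a x = Q2 n (a(h := 0)) (x :: 'a)"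
proof -
  have "(n - 1) div 2 = h - 1" "n div 2 = h" using assms by auto
  moreover have "of_bit (abs_trace h (0 :: 'a)) = (\<Sum>i<h. (0 :: 'a) ^ (2 ^ i))"
    by (rule of_bit_abs_trace[OF char_2]) (simp add: zero_power)
  hence "abs_trace h (0 :: 'a) = 0"
    by (simp add: zero_power)
  moreover have "(\<Sum>i = 1..h - 1. of_bit (a i) * x ^ (2 ^ i + 1)) =
      (\<Sum>i = 1..h - 1. of_bit ((a(h := 0)) i) * x ^ (2 ^ i + 1))"
    by (rule sum.cong) (use \<open>h > 0\<close> in auto)
  ultimately show ?thesis
    by (simp add: Q1_def Q2_def)
qed

lemma count2_eq:
  assumes n: "n = 2 * h" and "h > 0" and s: "s \<le> n"
  shows "count2 TYPE('a) n s =
    card {A \<in> palindromes (2 * h). degree (gcd A (monom 1 n + 1)) = s}"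
proof -
  have "n div 2 = h" using n by simp
  hence "count2 TYPE('a) n s =
      card {a \<in> {1..h} \<rightarrow>\<^sub>E UNIV. degree (gcd (palindrome_of h a) (monom 1 n + 1)) = s}"
    by (simp only: count2_def plateaued_Q2_iff[OF n] s simp_thms)
  thus ?thesis
    using bij_betw_same_card[OF bij_betw_Collect[OF bij_betw_palindrome_of[OF \<open>h > 0\<close>]]]
    by simp
qed

lemma count1_eq:
  assumes n: "n = 2 * h" and "h > 0" and s: "s \<le> n"
  shows "count1 TYPE('a) n s =
    card {A \<in> {A \<in> palindromes (2 * h). coeff A h = 0}. degree (gcd A (monom 1 n + 1)) = s}"
proof -
  let ?D = "{1..h - 1} \<rightarrow>\<^sub>E (UNIV :: bit set)" and ?u = "\<lambda>a :: nat \<Rightarrow> bit. a(h := 0)"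
  let ?g = "\<lambda>a. palindrome_of h (?u a)"
  have "bij_betw ?u ?D {b \<in> {1..h} \<rightarrow>\<^sub>E UNIV. b h = 0}"
  \<comment> \<open>A tuple on {1..h - 1} has the value \<open>undefined\<close> at h, so restoring
    it there undoes the extension by 0.\<close>
  proof (rule bij_betwI[where g = "\<lambda>b. b(h := undefined)"])
    show "?u \<in> ?D \<rightarrow> {b \<in> {1..h} \<rightarrow>\<^sub>E UNIV. b h = 0}"
      using \<open>h > 0\<close> by (auto simp: PiE_iff extensional_def)
    show "(\<lambda>b. b(h := undefined)) \<in> {b \<in> {1..h} \<rightarrow>\<^sub>E UNIV. b h = 0} \<rightarrow> ?D"
      by (auto simp: PiE_iff extensional_def)
    show "(?u a)(h := undefined) = a" if "a \<in> ?D" for a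
      using that \<open>h > 0\<close> by (auto simp: PiE_iff extensional_def fun_eq_iff)
    show "?u (b(h := undefined)) = b" if "b \<in> {b \<in> {1..h} \<rightarrow>\<^sub>E UNIV. b h = 0}" for b
      using that by (auto simp: fun_eq_iff)
  qed
  moreover have "{b \<in> {1..h} \<rightarrow>\<^sub>E UNIV. b h = 0} =
      {b \<in> {1..h} \<rightarrow>\<^sub>E UNIV. coeff (palindrome_of h b) h = 0}"
    using \<open>h > 0\<close> by (simp add: coeff_palindrome_of)
  ultimately have "bij_betw (palindrome_of h \<circ> ?u) ?D {A \<in> palindromes (2 * h). coeff A h = 0}"
    using bij_betw_Collect[OF bij_betw_palindrome_of[OF \<open>h > 0\<close>], of "\<lambda>A. coeff A h = 0"]
    by (intro bij_betw_trans) auto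
  from bij_betw_same_card[OF bij_betw_Collect[OF this]]
  have "card {a \<in> ?D. degree (gcd (?g a) (monom 1 n + 1)) = s} =
      card {A \<in> {A \<in> palindromes (2 * h). coeff A h = 0}. degree (gcd A (monom 1 n + 1)) = s}"
    by simp
  moreover have "count1 TYPE('a) n s = card {a \<in> ?D. degree (gcd (?g a) (monom 1 n + 1)) = s}"
  proof -
    have "Q1 n a = (Q2 n (?u a) :: 'a \<Rightarrow> bit)" for a
      using Q1_eq_Q2[OF n \<open>h > 0\<close>] by blast
    moreover have "(n - 1) div 2 = h - 1" using n by auto
    ultimately show ?thesis
      by (simp only: count1_def plateaued_Q2_iff[OF n] s simp_thms)
  qed
  ultimately show ?thesis by simp
qed

text \<open>Collects X by t = n - degree of the gcd; the gcd divides x^n + 1, so no degree exceeds n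
  and the truncated subtraction is exact.\<close>

lemma sum_monom_card_degree_gcd:
  fixes X :: "bit poly set"
  assumes "finite X"
  shows "(\<Sum>t = 0..n. monom (int (card {A \<in> X. degree (gcd A (monom 1 n + 1)) = n - t})) t) =
    (\<Sum>A\<in>X. monom (1 :: int) (n - degree (gcd A (monom 1 n + 1))))"
proof -
  let ?d = "\<lambda>A :: bit poly. degree (gcd A (monom 1 n + 1))"
  have nz: "(monom 1 n + 1 :: bit poly) \<noteq> 0"
    using degree_x_n_plus_1 n_pos by (metis degree_0 less_irrefl)
  have le: "?d A \<le> n" for A
    using dvd_imp_degree_le[OF gcd_dvd2 nz] degree_x_n_plus_1 by metis
  have "(\<Sum>A\<in>X. monom (1 :: int) (n - ?d A)) =
      (\<Sum>t = 0..n. \<Sum>A | A \<in> X \<and> n - ?d A = t. monom (1 :: int) (n - ?d A))"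
    by (rule sum.group[symmetric]) (use assms in auto)
  also have "\<dots> = (\<Sum>t = 0..n. monom (int (card {A \<in> X. ?d A = n - t})) t)"
  proof (rule sum.cong[OF refl])
    fix t assume "t \<in> {0..n}"
    hence "{A. A \<in> X \<and> n - ?d A = t} = {A \<in> X. ?d A = n - t}"
      using le diff_diff_cancel by (metis (lifting) atLeastAtMost_iff)
    hence "(\<Sum>A | A \<in> X \<and> n - ?d A = t. monom (1 :: int) (n - ?d A)) =
        (\<Sum>A\<in>{A \<in> X. ?d A = n - t}. monom 1 t)"
      by (intro sum.cong) auto
    also have "\<dots> = monom (int (card {A \<in> X. ?d A = n - t})) t"
      by (simp add: of_nat_poly smult_monom)
    finally show "(\<Sum>A | A \<in> X \<and> n - ?d A = t. monom (1 :: int) (n - ?d A)) =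
      monom (int (card {A \<in> X. ?d A = n - t})) t" .
  qed
  finally show ?thesis by simp
qed

end

theorem theorem1:
  fixes n v m k :: nat
    and r :: "nat \<Rightarrow> bit poly"
  assumes "card (UNIV :: 'a::{finite, field} set) = 2 ^ n"
    and "n = 2 ^ v * m" and "odd m" and "v > 0"
    and "\<And>i. i \<in> {1..k} \<Longrightarrow> lead_coeff (r i) = 1"
    and "\<And>i. i \<in> {1..k} \<Longrightarrow> prime_self_reciprocal (r i)"
    and "\<And>i. i \<in> {1..k} \<Longrightarrow> even (degree (r i))"
    and "(monom 1 n + 1 :: bit poly) = [:1, 1:] ^ (2 ^ v) * (\<Prod>i = 1..k. r i ^ (2 ^ v))"
  shows "(\<Sum>t = 0..n. monom (int (count1 TYPE('a) n (n - t))) t) =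
           (1 + (\<Sum>j = 1..2 ^ (v - 1) - 1. monom (2 ^ (j - 1)) (2 * j))) *
           (\<Prod>i = 1..k. G_factor v (degree (r i)))
       \<and> (\<Sum>t = 0..n. monom (int (count2 TYPE('a) n (n - t))) t) =
           (1 + (\<Sum>j = 1..2 ^ (v - 1). monom (2 ^ (j - 1)) (2 * j))) *
           (\<Prod>i = 1..k. G_factor v (degree (r i)))"
proof -
  interpret binary_field n "TYPE('a)"
    by unfold_locales fact
  define h where "h = n div 2"
  have n: "n = 2 * h"
    using assms(2,4) by (simp add: h_def)
  hence h: "h > 0"
    using n_pos by simp
  let ?P = "monom 1 n + 1 :: bit poly"
  define p where "p = (\<lambda>i :: nat. if i = 0 then [:1, 1:]\<^sup>2 else r i)"
  define N where "N = (\<lambda>i :: nat. if i = 0 then 2 ^ (v - 1) else 2 ^ v :: nat)"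
  have two_v: "2 * 2 ^ (v - 1) = (2 ^ v :: nat)"
    using assms(4) by (cases v) auto

  \<comment> \<open>Each base occurs once in the product of the R i. Its 2^v-th power is x^n + 1 =
    (x^m + 1)^(2^v), so the product is the squarefree x^m + 1, which makes the factors pairwise
    coprime.\<close>
  define R where "R = (\<lambda>i :: nat. if i = 0 then [:1, 1:] else r i)"
  have "(\<Prod>i = 0..k. R i) = monom 1 m + 1"
  proof (rule power_eq_bit_poly)
    have "(\<Prod>i = 0..k. R i) ^ (2 ^ v) = ?P"
      unfolding assms(8) prod_atMost_split_first power_mult_distrib prod_power_distrib
      by (simp add: R_def)
    also have "\<dots> = (monom 1 m + 1) ^ (2 ^ v)"
      by (simp add: add_power_bit_poly monom_power assms(2) mult.commute)
    finally show "(\<Prod>i = 0..k. R i) ^ (2 ^ v) = (monom 1 m + 1) ^ (2 ^ v)" .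
  qed
  hence squarefree: "squarefree (\<Prod>i = 0..k. R i)"
    using squarefree_x_m_plus_1[OF assms(3)] by simp
  interpret palindromic_factorisation "{0..k}" p N ?P h
  proof
    show "palindromic_prime (p i)" if "i \<in> {0..k}" for i
      using that assms(6,7)
      by (auto simp: p_def palindromic_prime_x_plus_1_square
          intro!: palindromic_prime_if_prime_self_reciprocal)
    show "coprime (p i) (p j)" if "i \<in> {0..k}" "j \<in> {0..k}" "i \<noteq> j" for i j
    proof -
      have "(\<Prod>l\<in>{i, j}. R l) dvd (\<Prod>l = 0..k. R l)"
        by (rule prod_dvd_prod_subset) (use that in auto)
      hence "R i * R j dvd (\<Prod>l = 0..k. R l)"
        using that by simp
      hence "squarefree (R i * R j)"
        using squarefree by (rule squarefree_mono)
      hence "coprime (R i) (R j)"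
        by (rule coprime_if_squarefree_mult)
      thus ?thesis by (auto simp: p_def R_def split: if_splits)
    qed
    have "[:1, 1:] ^ (2 ^ v) = p 0 ^ N 0"
      by (simp only: p_def N_def refl if_True two_v flip: power_mult)
    moreover have "(\<Prod>i = 1..k. r i ^ (2 ^ v)) = (\<Prod>i = 1..k. p i ^ N i)"
      by (rule prod.cong) (auto simp: p_def N_def)
    ultimately show "?P = (\<Prod>i = 0..k. p i ^ N i)"
      unfolding assms(8) prod_atMost_split_first by (simp only:)
    show "degree ?P = 2 * h"
      using degree_x_n_plus_1 n by simp
  qed simp

  have deg_0: "degree (p 0) = 2"
    by (simp add: p_def degree_power_eq)
  have G: "(\<Prod>i = 1..k. \<Sum>e\<in>{..N i}.
      monom (exponent_weight (N i) (degree (p i) div 2) e) ((N i - e) * degree (p i))) =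
      (\<Prod>i = 1..k. G_factor v (degree (r i)))"
  proof (rule prod.cong[OF refl])
    fix i assume i: "i \<in> {1..k}"
    have "j * degree (r i) div 2 = j * (degree (r i) div 2)" for j
      using assms(7)[OF i] by (simp add: div_mult_swap)
    thus "(\<Sum>e\<in>{..N i}. monom (exponent_weight (N i) (degree (p i) div 2) e)
        ((N i - e) * degree (p i))) = G_factor v (degree (r i))"
      using i by (simp add: N_def p_def G_factor_def atMost_atLeast0 sum_monom_exponent_weight
          del: power_Suc)
  qed
  \<comment> \<open>For (x + 1)^2 half the degree is 1, so the weight 2^j - 2^(j - 1) collapses to
    2^(j - 1). The lower end a of the exponent range shortens the sum over j.\<close>
  have factor_0: "(\<Sum>e = a..N 0.
      monom (exponent_weight (N 0) (degree (p 0) div 2) e) ((N 0 - e) * degree (p 0))) =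
      1 + (\<Sum>j = 1..2 ^ (v - 1) - a. monom (2 ^ (j - 1)) (2 * j))" if "a \<le> 1" for a
  proof -
    have "a \<le> N 0"
      using that by (rule order.trans) (simp add: N_def)
    hence "(\<Sum>e = a..N 0. monom (exponent_weight (N 0) 1 e) ((N 0 - e) * 2)) =
        1 + (\<Sum>j = 1..N 0 - a. monom (2 ^ (j * 1) - 2 ^ ((j - 1) * 1)) (j * 2))"
      by (rule sum_monom_exponent_weight)
    also have "(\<Sum>j = 1..N 0 - a. monom (2 ^ (j * 1) - 2 ^ ((j - 1) * 1)) (j * 2)) =
        (\<Sum>j = 1..N 0 - a. monom (2 ^ (j - 1) :: int) (2 * j))"
    proof (rule sum.cong[OF refl])
      fix j assume "j \<in> {1..N 0 - a}"
      thus "monom (2 ^ (j * 1) - 2 ^ ((j - 1) * 1)) (j * 2) = monom (2 ^ (j - 1) :: int) (2 * j)"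
        by (cases j) (auto simp: mult.commute)
    qed
    finally show ?thesis
      by (simp add: deg_0 N_def)
  qed

  let ?S1 = "{A \<in> palindromes (2 * h). coeff A h = 0}"
  have "finite ?S1" by simp
  let ?T = "\<lambda>i. if i = 0 then {1..N 0} else {..N i}"
  \<comment> \<open>A vanishing middle coefficient means that x + 1, hence (x + 1)^2, divides A;
    this is a condition on the exponent at index 0 alone.\<close>
  have "coeff A h = 0 \<longleftrightarrow> (\<forall>i\<in>{0..k}. expo A i \<in> ?T i)" if A: "A \<in> palindromes (2 * h)" for A
  proof -
    have "coeff A h = 0 \<longleftrightarrow> [:1, 1:] dvd A"
      using x_plus_1_dvd_palindrome_iff[OF h A] by simp
    also have "\<dots> \<longleftrightarrow> p 0 ^ 1 dvd A"
      using x_plus_1_square_dvd_palindrome[OF A] dvd_mult_left[of "[:1, 1:]" "[:1, 1:]" A]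
      by (auto simp: p_def power2_eq_square)
    also have "\<dots> \<longleftrightarrow> 1 \<le> expo A 0"
      by (rule power_dvd_iff) (auto simp: N_def)
    also have "\<dots> \<longleftrightarrow> (\<forall>i\<in>{0..k}. expo A i \<in> ?T i)"
      using expo_Max(1)[of _ A] by auto
    finally show ?thesis .
  qed
  hence S1: "?S1 = {A. A \<in> palindromes (2 * h) \<and> (\<forall>i\<in>{0..k}. expo A i \<in> ?T i)}"
    by blast
  have "(\<Sum>t = 0..n. monom (int (count1 TYPE('a) n (n - t))) t) =
      (\<Sum>A\<in>?S1. monom 1 (2 * h - degree (gcd A ?P)))"
    using sum_monom_card_degree_gcd[OF \<open>finite ?S1\<close>] by (simp add: count1_eq[OF n h] n[symmetric])
  also have "\<dots> = (\<Prod>i = 0..k. \<Sum>e\<in>?T i.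
      monom (exponent_weight (N i) (degree (p i) div 2) e) ((N i - e) * degree (p i)))"
    unfolding S1 by (rule gcd_degree_generating_function) auto
  also have "\<dots> = (\<Sum>e = 1..N 0.
      monom (exponent_weight (N 0) (degree (p 0) div 2) e) ((N 0 - e) * degree (p 0))) *
      (\<Prod>i = 1..k. \<Sum>e\<in>{..N i}.
      monom (exponent_weight (N i) (degree (p i) div 2) e) ((N i - e) * degree (p i)))"
    unfolding prod_atMost_split_first by (intro arg_cong2[where f = "(*)"] prod.cong) auto
  also have "\<dots> = (1 + (\<Sum>j = 1..2 ^ (v - 1) - 1. monom (2 ^ (j - 1)) (2 * j))) *
      (\<Prod>i = 1..k. G_factor v (degree (r i)))"
    by (simp only: G factor_0 order.refl)
  finally have count1: "(\<Sum>t = 0..n. monom (int (count1 TYPE('a) n (n - t))) t) = \<dots>" .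

  let ?S2 = "palindromes (2 * h)"
  have "finite ?S2" by simp
  have S2: "?S2 = {A. A \<in> palindromes (2 * h) \<and> (\<forall>i\<in>{0..k}. expo A i \<in> {..N i})}"
    using expo_Max(1) by auto
  have "(\<Sum>t = 0..n. monom (int (count2 TYPE('a) n (n - t))) t) =
      (\<Sum>A\<in>?S2. monom 1 (2 * h - degree (gcd A ?P)))"
    using sum_monom_card_degree_gcd[OF \<open>finite ?S2\<close>] by (simp add: count2_eq[OF n h] n[symmetric])
  also have "\<dots> = (\<Prod>i = 0..k. \<Sum>e\<in>{..N i}.
      monom (exponent_weight (N i) (degree (p i) div 2) e) ((N i - e) * degree (p i)))"
    by (subst S2) (rule gcd_degree_generating_function, auto)
  also have "\<dots> = (1 + (\<Sum>j = 1..2 ^ (v - 1). monom (2 ^ (j - 1)) (2 * j))) *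
      (\<Prod>i = 1..k. G_factor v (degree (r i)))"
    unfolding prod_atMost_split_first G unfolding atMost_atLeast0 factor_0[OF zero_le] by simp
  finally show ?thesis using count1 by blast
qed

end
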